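(* There is a one-sided property testing algorithm for $k$-edge connectivity of directed graphs with false-reject probability at most $\tfrac13$ that performs $O\big(\tfrac{k^4}{(\epsilon\overline d)^2}\log(\tfrac{k}{\epsilon\overline d})\big)$ many queries in unbounded-degree graphs and $O\big(\tfrac{k^3}{\epsilon}(\log(\tfrac{k}{\epsilon d}))^2\big)$ many queries in bounded-degree graphs.
   Context: $G=(V,E)$ is a directed graph with $n$ vertices and $m$ edges; $\overline d=m/n$. Queries are incidence-list queries: the $i$-th outgoing or $i$-th incoming edge of a vertex ($\bot$ if none). $k$-edge connected: strongly connected whenever fewer than $k$ edges are removed. Unbounded-degree model: $\epsilon$-far means more than $\epsilon n\overline d$ edge modifications are needed to obtain the property. Bounded-degree model: $d$ is a given upper bound on every vertex's in- and out-degree, and $\epsilon$-far means more than $\epsilon nd$ edge modifications are needed. A property testing algorithm knows $n$ and $d$ or $\overline d$ (and $m$), is given $\epsilon,k$, and with probability at least $\tfrac23$ accepts graphs with the property and rejects graphs $\epsilon$-far from it; one-sided means graphs with the property are always accepted. *)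

theory Defs
  imports
    "HOL-Probability.Probability_Mass_Function"
    "Graph_Theory.Pair_Digraph"
    "Graph_Theory.Digraph_Component"
begin

type_synonym graph = "nat pair_pre_digraph"

(* Graphs (V,E) with V = {0,...,n-1} and E a subset of V x V (so no parallel edges; loops,
   which do not affect connectivity, are not excluded).  The vertex names are known to the
   algorithm, which can therefore sample vertices. *)
definition digraph_on :: "nat \<Rightarrow> graph \<Rightarrow> bool" where
  "digraph_on n G \<longleftrightarrow> pair_fin_digraph G \<and> pverts G = {..<n}"

definition graphs_with_edges :: "nat \<Rightarrow> nat \<Rightarrow> graph set" where
  "graphs_with_edges n m = {G. digraph_on n G \<and> card (parcs G) = m}"

definition graphs_with_degree_bound :: "nat \<Rightarrow> nat \<Rightarrow> graph set" where
  "graphs_with_degree_bound n d =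
     {G. digraph_on n G \<and>
         (\<forall>v \<in> pverts G. out_degree (with_proj G) v \<le> d \<and> in_degree (with_proj G) v \<le> d)}"

definition k_edge_connected :: "nat \<Rightarrow> graph \<Rightarrow> bool" where
  "k_edge_connected k G \<longleftrightarrow>
     (\<forall>F \<subseteq> parcs G. card F < k \<longrightarrow> strongly_connected (with_proj (G\<lparr>parcs := parcs G - F\<rparr>)))"

(* Least number of edge insertions and deletions turning G into H, on the same vertex set. *)
definition edge_modifications :: "graph \<Rightarrow> graph \<Rightarrow> nat" where
  "edge_modifications G H = card ((parcs G - parcs H) \<union> (parcs H - parcs G))"

(* More than b edge modifications are needed to obtain P.  The modified graph is only required to
   have P; it may have another number of edges, or larger degrees, than G. *)
definition far_from :: "(graph \<Rightarrow> bool) \<Rightarrow> real \<Rightarrow> graph \<Rightarrow> bool" where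
  "far_from P b G \<longleftrightarrow>
     (\<forall>H. pair_fin_digraph H \<and> pverts H = pverts G \<and> P H \<longrightarrow> real (edge_modifications G H) > b)"

(* OutEdge v i and InEdge v i ask for the i-th outgoing and incoming edge of v, counting from 0;
   None is the answer bottom. *)
datatype query = OutEdge nat nat | InEdge nat nat

type_synonym answer = "(nat \<times> nat) option"
type_synonym query_access = "query \<Rightarrow> answer"

(* The orders of the incidence lists are arbitrary, so a graph has many query accesses. *)
definition incidence_list_access :: "graph \<Rightarrow> query_access \<Rightarrow> bool" where
  "incidence_list_access G q \<longleftrightarrow>
     (\<exists>outs ins.
        (\<forall>v. distinct (outs v) \<and> set (outs v) = out_arcs (with_proj G) v \<and>
             distinct (ins v) \<and> set (ins v) = in_arcs (with_proj G) v) \<and>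
        (\<forall>v i. q (OutEdge v i) = (if i < length (outs v) then Some (outs v ! i) else None) \<and>
               q (InEdge v i) = (if i < length (ins v) then Some (ins v ! i) else None)))"

(* A deterministic adaptive query algorithm; Verdict True accepts. *)
datatype decision_tree = Verdict bool | Query query "answer \<Rightarrow> decision_tree"

primrec accepts :: "query_access \<Rightarrow> decision_tree \<Rightarrow> bool" where
  "accepts q (Verdict b) = b"
| "accepts q (Query x c) = accepts q (c (q x))"

primrec num_queries :: "query_access \<Rightarrow> decision_tree \<Rightarrow> nat" where
  "num_queries q (Verdict b) = 0"
| "num_queries q (Query x c) = Suc (num_queries q (c (q x)))"

(* A randomized query algorithm draws all its random bits in advance. *)
type_synonym randomized_algorithm = "decision_tree pmf"

definition accept_prob :: "query_access \<Rightarrow> randomized_algorithm \<Rightarrow> real" where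
  "accept_prob q A = measure_pmf.prob A {T. accepts q T}"

definition reject_prob :: "query_access \<Rightarrow> randomized_algorithm \<Rightarrow> real" where
  "reject_prob q A = measure_pmf.prob A {T. \<not> accepts q T}"

(* b is the number of modifications above which a graph counts as far from P. *)
definition one_sided_tester ::
  "graph set \<Rightarrow> (graph \<Rightarrow> bool) \<Rightarrow> real \<Rightarrow> randomized_algorithm \<Rightarrow> bool" where
  "one_sided_tester Gs P b A \<longleftrightarrow>
     (\<forall>G \<in> Gs. \<forall>q. incidence_list_access G q \<longrightarrow>
        (P G \<longrightarrow> accept_prob q A = 1) \<and>
        (far_from P b G \<longrightarrow> reject_prob q A \<ge> 2 / 3))"

(* Worst case over the inputs and over the random choices. *)
definition performs_at_most ::
  "graph set \<Rightarrow> randomized_algorithm \<Rightarrow> real \<Rightarrow> bool" where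
  "performs_at_most Gs A t \<longleftrightarrow>
     (\<forall>G \<in> Gs. \<forall>q. incidence_list_access G q \<longrightarrow>
        (\<forall>T \<in> set_pmf A. real (num_queries q T) \<le> t))"

(* The logarithm inside an O-bound.  The truncation at 1 matters only for x < exp 1, where ln x
   tends to 0 as x tends to 1 and a bound with the bare logarithm would exclude even one query. *)
definition O_log :: "real \<Rightarrow> real" where
  "O_log x = max 1 (ln x)"

end

theory Submission
  imports Defs
begin

text \<open>A graph fails to be \<open>k\<close>-edge connected iff fewer than \<open>k\<close> arcs leave some nonempty proper
  vertex set. If more than \<open>16 k\<^sup>2\<close> modifications are needed, there are many disjoint such
  sets in the graph or in its converse: a minimal vector of additional out-degrees that
  satisfies all cuts is carried by disjoint tight sets, and \<open>k + 1\<close> hubs realise it by simple arcs.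
  Hence \<open>p\<close> disjoint deficient sets exist with \<open>p\<close> proportional to \<open>B / k\<close>, where \<open>B\<close> is the
  number of modifications, most of them of size \<open>O(n / p)\<close>. Vertices are sampled
  and a local search is started from each of them. It maintains arc-disjoint paths to random end
  points; an end point outside a deficient set \<open>X\<close> uses up one of the fewer than \<open>k\<close> arcs leaving \<open>X\<close>,
  so the search soon gets stuck inside a deficient set, which certifies rejection. Letting the size
  bound of the \<open>j\<close>-th search decrease like \<open>1 / j\<close> keeps the total number of queries small.\<close>

section \<open>Cuts and distance to connectivity\<close>

text \<open>Arcs have no multiplicity, so missing out-degree cannot be made up by parallel arcs.
  Pairwise joined hubs avoid this at an additive price of order k^2, and for this reason deficient
  families are extracted only when B is large against k^2. Missing out-arcs and missing in-arcs are
  covered separately: a set with few entering arcs is deficient in the converse graph, while in the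
  graph itself only its complement is, which may be far too large to explore. Hence every test is
  run on both kinds of incidence lists. A search for sets of at most s vertices makes k explorations
  of 3 k \<nu>(s) queries each, where \<nu>(s) bounds the number of arcs with tail in the set.
  Without parallel arcs and with fewer than k < s leaving arcs, \<nu>(s) is of order s^2; a degree
  bound gives s (d + 1). For s = R / j with R of order k n / B, the costs sum up to k^2 R^2 times a
  convergent series, and to k^2 d R times a harmonic sum. Searches are not repeated to amplify their
  success: failing with probability 1/3 only puts a constant factor on the chance that a sample
  leads to rejection.\<close>

definition cut_size :: "'a rel \<Rightarrow> 'a set \<Rightarrow> nat" where
  "cut_size E X = card (E \<inter> X \<times> - X)"

lemma cut_size_mono: "finite E' \<Longrightarrow> E \<subseteq> E' \<Longrightarrow> cut_size E X \<le> cut_size E' X"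
  unfolding cut_size_def by (intro card_mono) auto

text \<open>An arc leaving X \<inter> Y or X \<union> Y leaves X or Y, and an arc leaving both of
  the former leaves both of the latter.\<close>

lemma cut_size_submodular:
  assumes "finite E"
  shows "cut_size E (X \<inter> Y) + cut_size E (X \<union> Y) \<le> cut_size E X + cut_size E Y"
proof -
  let ?d = "\<lambda>X. E \<inter> X \<times> - X"
  have "card (?d (X \<inter> Y)) + card (?d (X \<union> Y))
      = card (?d (X \<inter> Y) \<union> ?d (X \<union> Y)) + card (?d (X \<inter> Y) \<inter> ?d (X \<union> Y))"
    using assms by (intro card_Un_Int) auto
  also have "\<dots> \<le> card (?d X \<union> ?d Y) + card (?d X \<inter> ?d Y)"
    using assms by (intro add_mono card_mono) auto
  also have "\<dots> = card (?d X) + card (?d Y)"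
    using assms by (intro card_Un_Int[symmetric]) auto
  finally show ?thesis by (simp add: cut_size_def)
qed

lemma cut_size_converse: "cut_size (E\<inverse>) X = cut_size E (- X)"
proof -
  have "E\<inverse> \<inter> X \<times> - X = (E \<inter> (- X) \<times> - (- X))\<inverse>" by auto
  then show ?thesis unfolding cut_size_def by (simp only: card_inverse)
qed

text \<open>Passing to the converse yields complements in the whole type, whereas a deficient set
  has to lie in \<open>V\<close>; vertices beyond \<open>V\<close> carry no arcs.\<close>

lemma cut_size_Compl:
  assumes "E \<subseteq> V \<times> V" "X \<subseteq> V"
  shows "cut_size E (V - X) = cut_size E (- X)"
proof -
  have "E \<inter> (V - X) \<times> - (V - X) = E \<inter> (- X) \<times> - (- X)" using assms by auto
  then show ?thesis unfolding cut_size_def by simp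
qed

definition deficient :: "nat \<Rightarrow> 'a rel \<Rightarrow> 'a set \<Rightarrow> 'a set \<Rightarrow> bool" where
  "deficient k E V X \<longleftrightarrow> X \<noteq> {} \<and> X \<subset> V \<and> cut_size E X < k"

text \<open>Complementation in \<open>V\<close> exchanges the deficient sets of a graph and its
  converse, so that searches along in-lists are as sound as those along out-lists.\<close>

lemma deficient_converse:
  assumes "E \<subseteq> V \<times> V"
  shows "(\<exists>X. deficient k (E\<inverse>) V X) \<longleftrightarrow> (\<exists>X. deficient k E V X)"
proof -
  have *: "deficient k (E\<inverse>) V (V - X)" if "deficient k E V X" "E \<subseteq> V \<times> V" for E X
  proof -
    have "cut_size (E\<inverse>) (V - X) = cut_size (E\<inverse>) (- X)"
      using that by (intro cut_size_Compl) (auto simp: deficient_def)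
    with that show ?thesis by (auto simp: deficient_def cut_size_converse)
  qed
  from *[of E] *[of "E\<inverse>"] assms show ?thesis by (metis converse_converse converse_mono converse_Times)
qed

text \<open>Removing the arcs that leave a deficient set separates it from the rest. Conversely,
  after removal of \<open>F\<close> all arcs leaving the set reachable from \<open>u\<close> lie in
  \<open>F\<close>, so this set has a cut below \<open>k\<close> and can only be the whole vertex
  set.\<close>

lemma k_edge_connected_iff:
  assumes "pair_fin_digraph G" "pverts G \<noteq> {}"
  shows "k_edge_connected k G \<longleftrightarrow> \<not> (\<exists>X. deficient k (parcs G) (pverts G) X)"
proof -
  interpret pair_fin_digraph G by fact
  let ?E = "parcs G" and ?V = "pverts G"
  let ?H = "\<lambda>F. with_proj (G\<lparr>parcs := ?E - F\<rparr>)"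
  have step: "v \<in> X" if "u \<rightarrow>\<^sup>*\<^bsub>?H F\<^esub> v" "u \<in> X" "?E \<inter> X \<times> - X \<subseteq> F" for u v X F
    using that unfolding reachable_def
    by (induction rule: rtrancl_on_induct) auto
  show ?thesis
  proof
    assume con: "k_edge_connected k G"
    show "\<not> (\<exists>X. deficient k ?E ?V X)"
    proof
      assume "\<exists>X. deficient k ?E ?V X"
      then obtain X where X: "X \<noteq> {}" "X \<subset> ?V" "card (?E \<inter> X \<times> - X) < k"
        by (auto simp: deficient_def cut_size_def)
      then have "strongly_connected (?H (?E \<inter> X \<times> - X))"
        using con unfolding k_edge_connected_def by blast
      moreover obtain u v where "u \<in> X" "v \<in> ?V" "v \<notin> X" using X by blast
      ultimately show False using X step[of "?E \<inter> X \<times> - X" u v X]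
        by (auto simp: strongly_connected_def)
    qed
  next
    assume cuts: "\<not> (\<exists>X. deficient k ?E ?V X)"
    show "k_edge_connected k G"
      unfolding k_edge_connected_def
    proof (intro allI impI)
      fix F assume F: "F \<subseteq> ?E" "card F < k"
      show "strongly_connected (?H F)"
      proof (rule strongly_connectedI)
        show "verts (?H F) \<noteq> {}" using assms(2) by simp
      next
        fix u v assume uv: "u \<in> verts (?H F)" "v \<in> verts (?H F)"
        let ?X = "{w. u \<rightarrow>\<^sup>*\<^bsub>?H F\<^esub> w}"
        have sub: "?X \<subseteq> ?V" using in_rtrancl_on_in_F(2) unfolding reachable_def by fastforce
        have u: "u \<in> ?X" using uv unfolding reachable_def by (intro CollectI rtrancl_on_refl)
        have "(a, b) \<in> F" if "(a, b) \<in> ?E" "a \<in> ?X" "b \<notin> ?X" for a b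
        proof (rule ccontr)
          assume "(a, b) \<notin> F"
          then have ab: "(a, b) \<in> arcs_ends (?H F)" using that(1) by simp
          have b: "b \<in> verts (?H F)" using that(1) by (auto dest: wellformed')
          have "(u, a) \<in> rtrancl_on (verts (?H F)) (arcs_ends (?H F))"
            using that(2) unfolding reachable_def by (rule CollectD)
          then have "(u, b) \<in> rtrancl_on (verts (?H F)) (arcs_ends (?H F))"
            using ab b by (rule rtrancl_on_into_rtrancl_on)
          then have "b \<in> ?X" unfolding reachable_def by (rule CollectI)
          with that(3) show False by (rule notE)
        qed
        then have "?E \<inter> ?X \<times> - ?X \<subseteq> F" by auto
        then have "cut_size ?E ?X < k" unfolding cut_size_def
          using F by (meson card_mono finite_subset le_less_trans pair_finite_arcs)
        then have "deficient k ?E ?V ?X" if "?X \<noteq> ?V"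
          unfolding deficient_def using that sub u by (intro conjI psubsetI) (rule notI, simp only: empty_iff)
        then have "?X = ?V" using cuts by (meson exI)
        moreover have "v \<in> ?V" using uv by simp
        ultimately have "v \<in> ?X" by (simp only:)
        then show "u \<rightarrow>\<^sup>*\<^bsub>?H F\<^esub> v" by (rule CollectD)
      qed
    qed
  qed
qed

text \<open>A vertex with \<open>k\<close> out-neighbours besides itself has at most |X| - 1 of them
  in X. If this held for all vertices of X, at least |X| (k + 1 - |X|) \<ge> k arcs would leave
  X.\<close>

lemma cut_size_singletons:
  assumes "finite E" "finite X" "X \<noteq> {}" "card X \<le> k" "cut_size E X < k"
  shows "\<exists>v\<in>X. cut_size E {v} < k"
proof (rule ccontr)
  assume "\<not> ?thesis"
  then have ge: "k \<le> cut_size E {v}" if "v \<in> X" for v using that by force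
  let ?s = "card X" and ?B = "E \<inter> X \<times> - X"
  have "k + 1 \<le> card (?B \<inter> {v} \<times> UNIV) + ?s" if "v \<in> X" for v
  proof -
    have "E \<inter> {v} \<times> - {v} \<subseteq> (?B \<inter> {v} \<times> UNIV) \<union> {v} \<times> (X - {v})" using that by auto
    then have "cut_size E {v} \<le> card ((?B \<inter> {v} \<times> UNIV) \<union> {v} \<times> (X - {v}))"
      unfolding cut_size_def using assms by (intro card_mono) auto
    also have "\<dots> \<le> card (?B \<inter> {v} \<times> UNIV) + card ({v} \<times> (X - {v}))" by (rule card_Un_le)
    also have "card ({v} \<times> (X - {v})) = ?s - 1" using that assms by (simp add: card_cartesian_product)
    finally show ?thesis using ge[OF that] that assms by (cases ?s) auto
  qed
  then have "(\<Sum>v\<in>X. k + 1) \<le> (\<Sum>v\<in>X. card (?B \<inter> {v} \<times> UNIV) + ?s)" by (rule sum_mono)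
  also have "\<dots> = (\<Sum>v\<in>X. card (?B \<inter> {v} \<times> UNIV)) + ?s * ?s" by (simp add: sum.distrib)
  also have "(\<Sum>v\<in>X. card (?B \<inter> {v} \<times> UNIV)) = card (\<Union>v\<in>X. ?B \<inter> {v} \<times> UNIV)"
    using assms by (intro card_UN_disjoint[symmetric]) auto
  also have "(\<Union>v\<in>X. ?B \<inter> {v} \<times> UNIV) = ?B" by auto
  finally have "?s * (k + 1) \<le> card ?B + ?s * ?s" by simp
  moreover have "card ?B < k" using assms by (simp add: cut_size_def)
  ultimately have "?s * (k + 1) < k + ?s * ?s" by linarith
  \<comment> \<open>In these terms |X| (k + 1 - |X|) = (i + 1) (j + 1), which is at least i + 1 + j
    = k.\<close>
  moreover obtain j where "k = ?s + j" using assms(4) le_Suc_ex by blast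
  moreover obtain i where "?s = Suc i" using assms by (cases ?s) auto
  ultimately show False by (simp add: algebra_simps)
qed

text \<open>The vector below is Frank's greedy covering vector. Maximal tight sets are disjoint by
  submodularity, unless two tight sets cover \<open>V\<close>.\<close>

lemma deficiency_cover:
  assumes "finite E" "finite V"
  obtains z F where "\<And>v. v \<in> V \<Longrightarrow> z v \<le> k"
    "\<And>X. X \<noteq> {} \<Longrightarrow> X \<subset> V \<Longrightarrow> k \<le> sum z X + cut_size E X"
    "\<And>X. X \<in> F \<Longrightarrow> deficient k E V X" "disjoint F" "sum z V \<le> k * card F + 2 * k"
proof -
  define covers where
    "covers z \<longleftrightarrow> (\<forall>X. X \<noteq> {} \<and> X \<subset> V \<longrightarrow> k \<le> sum z X + cut_size E X)" for z :: "'a \<Rightarrow> nat"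
  have fin: "finite X" if "X \<subseteq> V" for X using that assms(2) by (rule finite_subset)
  have "covers (\<lambda>_. k)" unfolding covers_def
  proof (intro allI impI)
    fix X assume "X \<noteq> {} \<and> X \<subset> V"
    then have "card X \<noteq> 0" using fin[of X] by auto
    then show "k \<le> (\<Sum>_\<in>X. k) + cut_size E X" by (cases "card X") auto
  qed
  then obtain z where z: "covers z" and min: "\<And>y. covers y \<Longrightarrow> sum z V \<le> sum y V"
    using ex_has_least_nat[of covers "\<lambda>_. k" "\<lambda>z. sum z V"] by auto
  define tight where "tight X \<longleftrightarrow> X \<noteq> {} \<and> X \<subset> V \<and> sum z X + cut_size E X = k" for X
  \<comment> \<open>By minimality, lowering \<open>z\<close> by one at \<open>v\<close> violates
    some covering inequality; its set contains \<open>v\<close> and was tight before.\<close>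
  have in_tight: "\<exists>X. tight X \<and> v \<in> X" if v: "v \<in> V" "z v > 0" for v
  proof -
    have split: "sum z A = z v + sum z (A - {v})" if "v \<in> A" "finite A" for A
      using that by (rule sum.remove[rotated])
    let ?y = "z(v := z v - 1)"
    have y: "sum ?y A = sum z A - 1" "sum z A \<ge> 1" if "v \<in> A" "finite A" for A
    proof -
      have "sum ?y A = ?y v + sum ?y (A - {v})" using that by (intro sum.remove) auto
      also have "sum ?y (A - {v}) = sum z (A - {v})" by (intro sum.cong) auto
      finally show "sum ?y A = sum z A - 1" "sum z A \<ge> 1"
        using split[OF that] v by auto
    qed
    have "\<not> covers ?y" using min[of ?y] y[OF v(1) assms(2)] by linarith
    then obtain X where X: "X \<noteq> {}" "X \<subset> V" "sum ?y X + cut_size E X < k"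
      unfolding covers_def not_all not_imp not_le by (elim exE conjE)
    have ge: "k \<le> sum z X + cut_size E X" using z X unfolding covers_def by blast
    have "v \<in> X"
    proof (rule ccontr)
      assume "v \<notin> X"
      then have "sum ?y X = sum z X" by (intro sum.cong) auto
      with X ge show False by simp
    qed
    then have "sum z X + cut_size E X = k" using X ge y[of X] fin[of X] by (simp add: psubset_imp_subset)
    with X \<open>v \<in> X\<close> show ?thesis unfolding tight_def by blast
  qed
  have le_k: "sum z X \<le> k" if "tight X" for X using that unfolding tight_def by simp
  have z_cov: "k \<le> sum z X + cut_size E X" if "X \<noteq> {}" "X \<subset> V" for X
    using z that unfolding covers_def by simp
  have z_le: "z v \<le> k" if "v \<in> V" for v
  proof (cases "z v = 0")
    case False
    then obtain X where X: "tight X" "v \<in> X" using in_tight \<open>v \<in> V\<close> by blast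
    then have "z v \<le> sum z X" using fin[of X] by (intro member_le_sum) (auto simp: tight_def)
    with le_k[OF X(1)] show ?thesis by simp
  qed simp
  show ?thesis
  \<comment> \<open>A tight set has \<open>z\<close>-weight at most \<open>k\<close>. Two of them
    covering \<open>V\<close> leave no proper subset to uncross to, but the summand
    \<open>2 * k\<close> then pays for everything and the empty family will do.\<close>
  proof (cases "\<exists>X Y. tight X \<and> tight Y \<and> X \<union> Y = V")
    case True
    then obtain X Y where XY: "tight X" "tight Y" "X \<union> Y = V" by blast
    then have "sum z V \<le> sum z X + sum z Y"
      using sum_Un_nat[of X Y z] fin[of X] fin[of Y] by (auto simp: tight_def)
    also have "\<dots> \<le> 2 * k" using XY le_k[of X] le_k[of Y] by simp
    finally show ?thesis by (intro that[of z "{}", OF z_le z_cov]) auto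
  next
    case False
    \<comment> \<open>Both the union and the intersection satisfy the covering inequality, while the
      values of \<open>X\<close> and \<open>Y\<close> add up to exactly \<open>2 * k\<close>;
      submodularity forces equality.\<close>
    have union: "tight (X \<union> Y)" if t: "tight X" "tight Y" "X \<inter> Y \<noteq> {}" for X Y
    proof -
      have ne: "X \<union> Y \<noteq> V" using False t by blast
      with t have U: "X \<union> Y \<noteq> {}" "X \<union> Y \<subset> V" and I: "X \<inter> Y \<noteq> {}" "X \<inter> Y \<subset> V"
        unfolding tight_def by auto
      have "k \<le> sum z (X \<union> Y) + cut_size E (X \<union> Y)" "k \<le> sum z (X \<inter> Y) + cut_size E (X \<inter> Y)"
        using z[unfolded covers_def, rule_format, OF conjI] U I by simp_all
      moreover have "sum z (X \<union> Y) + sum z (X \<inter> Y) = sum z X + sum z Y"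
        using t fin[of X] fin[of Y] by (intro sum.union_inter) (auto simp: tight_def)
      moreover have "cut_size E (X \<inter> Y) + cut_size E (X \<union> Y) \<le> cut_size E X + cut_size E Y"
        by (rule cut_size_submodular[OF assms(1)])
      ultimately show ?thesis using t U unfolding tight_def by linarith
    qed
    define M where "M = {X. tight X \<and> (\<forall>Y. tight Y \<and> X \<subseteq> Y \<longrightarrow> Y = X)}"
    have MV: "M \<subseteq> Pow V" unfolding M_def tight_def by auto
    have finM: "finite M" using MV assms(2) by (simp add: finite_subset)
    have disj: "X \<inter> Y = {}" if "X \<in> M" "Y \<in> M" "X \<noteq> Y" for X Y
    proof (rule ccontr)
      assume "X \<inter> Y \<noteq> {}"
      then have "tight (X \<union> Y)" using union that unfolding M_def by blast
      then show False using that unfolding M_def by (metis (mono_tags, lifting) Un_upper1 Un_upper2 mem_Collect_eq)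
    qed
    have in_M: "\<exists>X\<in>M. v \<in> X" if v: "v \<in> V" "z v > 0" for v
    proof -
      obtain X where X: "tight X" "v \<in> X" using in_tight[OF v] by blast
      have "finite {Y. tight Y}"
        by (rule finite_subset[of _ "Pow V"]) (use assms(2) in \<open>auto simp: tight_def\<close>)
      then obtain Y where Y: "X \<subseteq> Y" "tight Y" "\<And>W. tight W \<Longrightarrow> Y \<subseteq> W \<Longrightarrow> Y = W"
        using finite_has_maximal2[of "{Y. tight Y}" X] X by auto
      then show ?thesis using X unfolding M_def by blast
    qed
    \<comment> \<open>A tight set of weight 0 has exactly \<open>k\<close> leaving arcs and is not
      deficient.\<close>
    define F where "F = {X\<in>M. sum z X > 0}"
    have "sum z V = sum z (\<Union>F)"
    proof (rule sum.mono_neutral_right)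
      show "\<forall>v\<in>V - \<Union>F. z v = 0"
      proof
        fix v assume v: "v \<in> V - \<Union>F"
        show "z v = 0"
        proof (rule ccontr)
          assume "z v \<noteq> 0"
          then obtain X where X: "X \<in> M" "v \<in> X" using in_M v by blast
          then have "z v \<le> sum z X" using fin[of X] MV by (intro member_le_sum) auto
          then have "X \<in> F" using X \<open>z v \<noteq> 0\<close> unfolding F_def by auto
          with X v show False by blast
        qed
      qed
    qed (use MV assms in \<open>auto simp: F_def\<close>)
    also have "\<dots> = (\<Sum>X\<in>F. sum z X)"
      using disj fin MV by (subst sum.Union_disjoint) (auto simp: F_def)
    also have "\<dots> \<le> (\<Sum>X\<in>F. k)" using le_k by (intro sum_mono) (auto simp: F_def M_def)
    also have "\<dots> = k * card F" by simp
    finally have "sum z V \<le> k * card F + 2 * k" by simp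
    moreover have "deficient k E V X" if "X \<in> F" for X
      using that unfolding F_def M_def tight_def deficient_def by auto
    moreover have "disjoint F" using disj unfolding F_def by (auto simp: disjoint_def)
    ultimately show ?thesis by (intro that[of z F, OF z_le z_cov]) auto
  qed
qed

text \<open>Each vertex gets up to \<open>z v\<close> new arcs to hubs that it does not reach yet.
  If the hubs do not suffice for some \<open>v\<close> in \<open>X\<close>, then \<open>v\<close>
  ends up joined to all \<open>k + 1\<close> hubs, which lie outside \<open>X\<close>; otherwise the
  new arcs contribute the full weight of \<open>X\<close>. The conclusion ranges over supergraphs
  because further arcs are added later.\<close>

lemma attach_to_hubs:
  assumes "finite V" "E \<subseteq> V \<times> V" "hub \<subseteq> V" "card hub = k + 1"
    and covers: "\<And>X. X \<noteq> {} \<Longrightarrow> X \<subset> V \<Longrightarrow> k \<le> sum z X + cut_size E X"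
  obtains N where "N \<subseteq> V \<times> V" "card N \<le> sum z V"
    "\<And>H X. finite H \<Longrightarrow> E \<union> N \<subseteq> H \<Longrightarrow> X \<noteq> {} \<Longrightarrow> X \<subseteq> V - hub \<Longrightarrow> k \<le> cut_size H X"
proof -
  have hub: "finite hub" "hub \<noteq> {}" using assms finite_subset by fastforce+
  have "\<exists>T. T \<subseteq> hub - E `` {v} \<and> card T = min (z v) (card (hub - E `` {v}))" for v
    using obtain_subset_with_card_n[of "min (z v) (card (hub - E `` {v}))"] by (metis min.cobounded2)
  then obtain S where S: "\<And>v. S v \<subseteq> hub - E `` {v}"
    and card_S: "\<And>v. card (S v) = min (z v) (card (hub - E `` {v}))" by metis
  have fin_S: "finite (S v)" for v using S hub(1) by (meson Diff_subset finite_subset)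
  define N where "N = (SIGMA v:V. S v)"
  have "card N = (\<Sum>v\<in>V. card (S v))" unfolding N_def using assms fin_S by simp
  also have "\<dots> \<le> sum z V" by (intro sum_mono) (simp add: card_S)
  finally have card_N: "card N \<le> sum z V" .
  have cut: "k \<le> cut_size H X"
    if H: "finite H" "E \<union> N \<subseteq> H" and X: "X \<noteq> {}" "X \<subseteq> V - hub" for H X
  proof (cases "\<exists>v\<in>X. card (hub - E `` {v}) < z v")
    case True
    then obtain v where v: "v \<in> X" "card (hub - E `` {v}) < z v" by blast
    then have "S v = hub - E `` {v}"
      using S[of v] card_S[of v] hub(1) by (intro card_subset_eq) auto
    have "(v, b) \<in> H" if "b \<in> hub" for b
    proof (cases "(v, b) \<in> E")
      case False
      then have "b \<in> S v" using that \<open>S v = _\<close> by simp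
      then have "(v, b) \<in> N" unfolding N_def using v(1) X by blast
      then show ?thesis using H by blast
    qed (use H in blast)
    then have "{v} \<times> hub \<subseteq> H \<inter> X \<times> - X" using v X by auto
    then have "card ({v} \<times> hub) \<le> cut_size H X"
      unfolding cut_size_def using H by (intro card_mono) auto
    then show ?thesis using assms by (simp add: card_cartesian_product)
  next
    case False
    have finX: "finite X" using X assms by (meson Diff_subset finite_subset)
    have "k \<le> sum z X + cut_size E X" using X hub assms(3) by (intro covers) auto
    also have "sum z X = (\<Sum>v\<in>X. card (S v))" using False card_S by (intro sum.cong) force+
    also have "\<dots> = card (SIGMA v:X. S v)" using finX fin_S by simp
    also have "\<dots> + cut_size E X = card ((SIGMA v:X. S v) \<union> (E \<inter> X \<times> - X))"
      unfolding cut_size_def using finX fin_S S finite_subset[of E H] H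
      by (intro card_Un_disjoint[symmetric]) auto
    also have "\<dots> \<le> cut_size H X"
      unfolding cut_size_def
    proof (rule card_mono)
      show "(SIGMA v:X. S v) \<union> E \<inter> X \<times> - X \<subseteq> H \<inter> X \<times> - X"
        using H(2) X(2) S unfolding N_def by auto
    qed (use H in simp)
    finally show ?thesis .
  qed
  have "N \<subseteq> V \<times> V" using S assms(3) unfolding N_def by auto
  with card_N cut show ?thesis by (intro that[of N])
qed

text \<open>A set containing some but not all of the \<open>k + 1\<close> hubs has at least \<open>k\<close> arcs between hubs
  leaving it; the attached arcs take care of the others.\<close>

lemma augmentation:
  assumes "finite V" "E \<subseteq> V \<times> V" "k < card V" "k \<ge> 1"
  shows "\<exists>H F F'. E \<subseteq> H \<and> H \<subseteq> V \<times> V \<and> (\<nexists>X. deficient k H V X) \<and>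
    (\<forall>X\<in>F. deficient k E V X) \<and> disjoint F \<and> (\<forall>X\<in>F'. deficient k (E\<inverse>) V X) \<and> disjoint F' \<and>
    card (H - E) \<le> 6 * k * card V \<and> card (H - E) \<le> 8 * k\<^sup>2 + k * (card F + card F')"
proof -
  have finE: "finite E" using assms by (meson finite_SigmaI finite_subset)
  obtain z F where z: "\<And>v. v \<in> V \<Longrightarrow> z v \<le> k"
      "\<And>X. X \<noteq> {} \<Longrightarrow> X \<subset> V \<Longrightarrow> k \<le> sum z X + cut_size E X"
    and F: "\<And>X. X \<in> F \<Longrightarrow> deficient k E V X" "disjoint F" "sum z V \<le> k * card F + 2 * k"
    by (rule deficiency_cover[OF finE assms(1)]) blast
  have finE': "finite (E\<inverse>)" using finE by simp
  obtain z' F' where z': "\<And>v. v \<in> V \<Longrightarrow> z' v \<le> k"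
      "\<And>X. X \<noteq> {} \<Longrightarrow> X \<subset> V \<Longrightarrow> k \<le> sum z' X + cut_size (E\<inverse>) X"
    and F': "\<And>X. X \<in> F' \<Longrightarrow> deficient k (E\<inverse>) V X" "disjoint F'" "sum z' V \<le> k * card F' + 2 * k"
    by (rule deficiency_cover[OF finE' assms(1)]) blast
  obtain hub where hub: "hub \<subseteq> V" "card hub = k + 1"
    by (metis Suc_eq_plus1 Suc_leI assms(3) obtain_subset_with_card_n)
  obtain N where N: "N \<subseteq> V \<times> V" "card N \<le> sum z V" and cutN:
      "\<And>H X. finite H \<Longrightarrow> E \<union> N \<subseteq> H \<Longrightarrow> X \<noteq> {} \<Longrightarrow> X \<subseteq> V - hub \<Longrightarrow> k \<le> cut_size H X"
    using attach_to_hubs[OF assms(1,2) hub z(2)] by metis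
  have E': "E\<inverse> \<subseteq> V \<times> V" using assms(2) by auto
  obtain N' where N': "N' \<subseteq> V \<times> V" "card N' \<le> sum z' V" and cutN':
      "\<And>H X. finite H \<Longrightarrow> E\<inverse> \<union> N' \<subseteq> H \<Longrightarrow> X \<noteq> {} \<Longrightarrow> X \<subseteq> V - hub \<Longrightarrow> k \<le> cut_size H X"
    using attach_to_hubs[OF assms(1) E' hub z'(2)] by metis
  define H where "H = E \<union> (hub \<times> hub \<union> (N \<union> N'\<inverse>))"
  have HV: "H \<subseteq> V \<times> V" using assms hub N N' unfolding H_def by auto
  then have finH: "finite H" using assms by (meson finite_SigmaI finite_subset)
  have "k \<le> cut_size H X" if X: "X \<noteq> {}" "X \<subset> V" for X
  proof -
    consider "hub \<inter> X = {}" | "hub - X = {}" | "hub \<inter> X \<noteq> {}" "hub - X \<noteq> {}"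
      by blast
    then show ?thesis
    proof cases
      case 1
      then have "X \<subseteq> V - hub" using X by blast
      then show ?thesis using X finH by (intro cutN) (auto simp: H_def)
    next
      case 2
      \<comment> \<open>The complement avoids the hubs, so the arcs attached in the converse graph
        apply to it.\<close>
      then have "V - X \<subseteq> V - hub" by blast
      then have "k \<le> cut_size (H\<inverse>) (V - X)"
        using X finH by (intro cutN') (auto simp: H_def)
      also have "\<dots> = cut_size (H\<inverse>) (- X)" using HV X by (intro cut_size_Compl) auto
      also have "\<dots> = cut_size H X" by (simp add: cut_size_converse)
      finally show ?thesis .
    next
      case 3
      have fh: "finite hub" using hub assms finite_subset by blast
      have "card (hub \<inter> X) + card (hub - X) = card hub"
        using fh by (metis Int_Diff_Un Int_Diff_disjoint card_Un_disjoint finite_Diff finite_Int)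
      moreover have "card (hub \<inter> X) \<noteq> 0" "card (hub - X) \<noteq> 0" using 3 fh by auto
      \<comment> \<open>Two positive numbers with sum \<open>k + 1\<close> have product at least
        \<open>k\<close>.\<close>
      ultimately have "k \<le> card (hub \<inter> X) * card (hub - X)"
        using hub by (cases "card (hub \<inter> X)"; cases "card (hub - X)") auto
      also have "\<dots> = card ((hub \<inter> X) \<times> (hub - X))" by (simp add: card_cartesian_product)
      also have "\<dots> \<le> cut_size H X"
        unfolding cut_size_def using finH by (intro card_mono) (auto simp: H_def)
      finally show ?thesis .
    qed
  qed
  then have cuts: "\<nexists>X. deficient k H V X" by (auto simp: deficient_def not_less)
  have "card (H - E) \<le> card (hub \<times> hub \<union> (N \<union> N'\<inverse>))"
    using finH by (intro card_mono) (auto simp: H_def)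
  also have "\<dots> \<le> card (hub \<times> hub) + (card N + card (N'\<inverse>))"
    by (meson card_Un_le add_left_mono order_trans)
  also have "\<dots> \<le> (k + 1) * (k + 1) + (sum z V + sum z' V)"
    using N N' hub by (simp add: card_cartesian_product)
  finally have le: "card (H - E) \<le> (k + 1) * (k + 1) + (sum z V + sum z' V)" .
  \<comment> \<open>The hubs cost at most \<open>4 * k\<^sup>2\<close>. With weights at most
    \<open>k\<close> per vertex in both directions this gives the factor 4 + 1 + 1 = 6; with twice
    the slack \<open>2 * k\<close> of the covers it gives 4 + 2 + 2 = 8.\<close>
  have sq: "(k + 1) * (k + 1) \<le> 4 * k\<^sup>2" "k \<le> k\<^sup>2"
    using mult_le_mono[of "k + 1" "2 * k" "k + 1" "2 * k"] assms(4) by (auto simp: power2_eq_square)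
  have "k\<^sup>2 \<le> k * card V" using assms(3) by (simp add: power2_eq_square)
  moreover have "sum z V \<le> card V * k" "sum z' V \<le> card V * k"
    using sum_bounded_above[of V z k] sum_bounded_above[of V z' k] z z' by auto
  ultimately have "card (H - E) \<le> 6 * k * card V" using le sq by (simp add: algebra_simps)
  moreover have "card (H - E) \<le> 8 * k\<^sup>2 + k * (card F + card F')"
    using le sq F(3) F'(3) by (simp add: algebra_simps)
  moreover have "E \<subseteq> H" by (auto simp: H_def)
  ultimately show ?thesis using HV cuts F F'
    by (intro exI[of _ H] exI[of _ F] exI[of _ F'] conjI ballI) simp_all
qed

text \<open>The arcs with tail in a set of at most \<open>k\<close> vertices may outnumber the square of its size,
  so that the tester looks for single vertices instead of such sets.\<close>

lemma small_or_large_deficient_family: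
  assumes "finite V" "E \<subseteq> V \<times> V" "\<forall>X\<in>F. deficient k E V X" "disjoint F"
  shows "\<exists>F'. (\<forall>X\<in>F'. deficient k E V X \<and> (card X = 1 \<or> k < card X)) \<and> disjoint F' \<and> card F' = card F"
proof -
  have finE: "finite E" using assms by (meson finite_SigmaI finite_subset)
  have "\<exists>Y\<subseteq>X. deficient k E V Y \<and> (card Y = 1 \<or> k < card Y)" if "X \<in> F" for X
  proof (cases "card X \<le> k")
    case True
    have X: "deficient k E V X" using that assms by blast
    then obtain v where "v \<in> X" "cut_size E {v} < k"
      using cut_size_singletons[OF finE, of X k] True assms(1) finite_subset[of X V]
      by (auto simp: deficient_def)
    with X show ?thesis by (intro exI[of _ "{v}"]) (auto simp: deficient_def)
  qed (use that assms in auto)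
  then obtain f where f: "\<And>X. X \<in> F \<Longrightarrow> f X \<subseteq> X \<and> deficient k E V (f X) \<and> (card (f X) = 1 \<or> k < card (f X))"
    by metis
  have disj: "f X \<inter> f Y = {}" if "X \<in> F" "Y \<in> F" "X \<noteq> Y" for X Y
    using that f[of X] f[of Y] assms(4) by (fastforce simp: disjoint_def)
  have "inj_on f F"
  proof (rule inj_onI)
    fix X Y assume XY: "X \<in> F" "Y \<in> F" "f X = f Y"
    then have "f X \<noteq> {}" using f[of X] by (auto simp: deficient_def)
    then show "X = Y" using disj[of X Y] XY by auto
  qed
  moreover have "disjoint (f ` F)" using disj by (fastforce simp: disjoint_def)
  ultimately show ?thesis using f by (intro exI[of _ "f ` F"] conjI) (auto simp: card_image)
qed

section \<open>Query logs\<close>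

text \<open>An entry pairs a vertex with the other end of its next list entry, or with
  \<open>None\<close> at the end of the list. Lists are read in order, so the position is the number
  of earlier entries of the vertex.\<close>

type_synonym query_log = "(nat \<times> nat option) list"

definition ask :: "bool \<Rightarrow> nat \<Rightarrow> nat \<Rightarrow> query" where
  "ask out v i = (if out then OutEdge v i else InEdge v i)"

definition neighbour :: "bool \<Rightarrow> answer \<Rightarrow> nat option" where
  "neighbour out = map_option (if out then snd else fst)"

definition history :: "query_log \<Rightarrow> nat \<Rightarrow> nat option list" where
  "history \<sigma> u = map snd (filter (\<lambda>e. fst e = u) \<sigma>)"

definition next_vertex :: "nat set \<Rightarrow> query_log \<Rightarrow> nat" where
  "next_vertex R \<sigma> = (SOME u. u \<in> R \<and> (u, None) \<notin> set \<sigma>)"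

definition scanned :: "nat set \<Rightarrow> query_log \<Rightarrow> bool" where
  "scanned R \<sigma> \<longleftrightarrow> (\<forall>u\<in>R. (u, None) \<in> set \<sigma>)"

text \<open>Exploring in continuation-passing style keeps the knowledge of a decision tree explicit; the
  function \<open>explored\<close> below is the log that results for given incidence lists \<open>nb\<close>.\<close>

primrec explore ::
  "bool \<Rightarrow> (query_log \<Rightarrow> nat set) \<Rightarrow> nat \<Rightarrow> query_log \<Rightarrow> (query_log \<Rightarrow> decision_tree) \<Rightarrow> decision_tree"
where
  "explore out sel 0 \<sigma> c = c \<sigma>"
| "explore out sel (Suc f) \<sigma> c =
     (if scanned (sel \<sigma>) \<sigma> then c \<sigma>
      else let u = next_vertex (sel \<sigma>) \<sigma> in
        Query (ask out u (length (history \<sigma> u)))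
          (\<lambda>a. explore out sel f (\<sigma> @ [(u, neighbour out a)]) c))"

definition nth_opt :: "'a list \<Rightarrow> nat \<Rightarrow> 'a option" where
  "nth_opt xs i = (if i < length xs then Some (xs ! i) else None)"

primrec explored ::
  "(nat \<Rightarrow> nat list) \<Rightarrow> (query_log \<Rightarrow> nat set) \<Rightarrow> nat \<Rightarrow> query_log \<Rightarrow> query_log"
where
  "explored nb sel 0 \<sigma> = \<sigma>"
| "explored nb sel (Suc f) \<sigma> =
     (if scanned (sel \<sigma>) \<sigma> then \<sigma>
      else let u = next_vertex (sel \<sigma>) \<sigma> in
        explored nb sel f (\<sigma> @ [(u, nth_opt (nb u) (length (history \<sigma> u)))]))"

text \<open>If \<open>out\<close> is false, the lists \<open>nb\<close> describe the converse graph;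
  this lets one analysis serve both directions.\<close>

definition answers_by :: "query_access \<Rightarrow> bool \<Rightarrow> (nat \<Rightarrow> nat list) \<Rightarrow> bool" where
  "answers_by q out nb \<longleftrightarrow> (\<forall>u i. neighbour out (q (ask out u i)) = nth_opt (nb u) i)"

lemma accepts_explore:
  "answers_by q out nb \<Longrightarrow> accepts q (explore out sel f \<sigma> c) = accepts q (c (explored nb sel f \<sigma>))"
  by (induction f arbitrary: \<sigma>) (auto simp: Let_def answers_by_def)

lemma num_queries_explore:
  assumes "\<And>\<sigma>. num_queries q (c \<sigma>) \<le> b"
  shows "num_queries q (explore out sel f \<sigma> c) \<le> f + b"
proof (induction f arbitrary: \<sigma>)
  case (Suc f)
  show ?case using Suc assms[of \<sigma>] by (auto simp: Let_def intro: le_trans)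
qed (use assms in simp)

text \<open>The prefix may be one longer than the list: the extra answer is the \<open>None\<close>
  after which a vertex is not asked again.\<close>

definition valid_log :: "(nat \<Rightarrow> nat list) \<Rightarrow> query_log \<Rightarrow> bool" where
  "valid_log nb \<sigma> \<longleftrightarrow>
     (\<forall>u. \<exists>i \<le> Suc (length (nb u)). history \<sigma> u = map (nth_opt (nb u)) [0..<i])"

definition arcs_of :: "(nat \<Rightarrow> nat list) \<Rightarrow> nat rel" where
  "arcs_of nb = {(u, w). w \<in> set (nb u)}"

definition known_arcs :: "query_log \<Rightarrow> nat rel" where
  "known_arcs \<sigma> = {(u, w). (u, Some w) \<in> set \<sigma>}"

lemma finite_known_arcs [simp]: "finite (known_arcs \<sigma>)"
proof -
  have "known_arcs \<sigma> \<subseteq> (\<lambda>(u, a). (u, the a)) ` set \<sigma>" unfolding known_arcs_def by force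
  then show ?thesis by (rule finite_subset) simp
qed

lemma in_set_history: "a \<in> set (history \<sigma> u) \<longleftrightarrow> (u, a) \<in> set \<sigma>"
  unfolding history_def by force

lemma valid_log_Nil [simp]: "valid_log nb []"
  unfolding valid_log_def history_def by auto

lemma valid_log_step:
  assumes "valid_log nb \<sigma>" "(u, None) \<notin> set \<sigma>"
  shows "valid_log nb (\<sigma> @ [(u, nth_opt (nb u) (length (history \<sigma> u)))])"
  unfolding valid_log_def
proof
  fix v
  let ?s = "\<sigma> @ [(u, nth_opt (nb u) (length (history \<sigma> u)))]"
  obtain i where i: "i \<le> Suc (length (nb v))" "history \<sigma> v = map (nth_opt (nb v)) [0..<i]"
    using assms unfolding valid_log_def by blast
  show "\<exists>i \<le> Suc (length (nb v)). history ?s v = map (nth_opt (nb v)) [0..<i]"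
  proof (cases "v = u")
    case True
    have "i \<noteq> Suc (length (nb u))"
    proof
      assume "i = Suc (length (nb u))"
      then have "None \<in> set (history \<sigma> u)" using i True by (auto simp: nth_opt_def)
      then show False using assms by (simp add: in_set_history)
    qed
    moreover have "history ?s u = history \<sigma> u @ [nth_opt (nb u) i]"
      using i True by (simp add: history_def)
    ultimately show ?thesis using i True by (intro exI[of _ "Suc i"]) auto
  next
    case False
    then have "history ?s v = history \<sigma> v" by (simp add: history_def)
    with i show ?thesis by auto
  qed
qed

lemma known_arcs_subset: "valid_log nb \<sigma> \<Longrightarrow> known_arcs \<sigma> \<subseteq> arcs_of nb"
proof (intro subrelI)
  fix u w assume "valid_log nb \<sigma>" "(u, w) \<in> known_arcs \<sigma>"
  then obtain i where "Some w \<in> set (map (nth_opt (nb u)) [0..<i])"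
    unfolding valid_log_def known_arcs_def by (metis (mono_tags) case_prodD in_set_history mem_Collect_eq)
  then show "(u, w) \<in> arcs_of nb" by (auto simp: arcs_of_def nth_opt_def split: if_splits)
qed

text \<open>The closing \<open>None\<close> is logged only after all entries of the list, so the
  visible cut of a scanned set is its true cut.\<close>

lemma known_arcs_scanned:
  assumes "valid_log nb \<sigma>" "scanned A \<sigma>"
  shows "known_arcs \<sigma> \<inter> A \<times> B = arcs_of nb \<inter> A \<times> B"
proof -
  have "(u, w) \<in> known_arcs \<sigma>" if "u \<in> A" "(u, w) \<in> arcs_of nb" for u w
  proof -
    obtain i where i: "history \<sigma> u = map (nth_opt (nb u)) [0..<i]"
      using assms unfolding valid_log_def by blast
    have "None \<in> set (history \<sigma> u)"
      using assms that unfolding scanned_def by (simp add: in_set_history)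
    then obtain j where "j < i" "nth_opt (nb u) j = None" unfolding i by auto
    then have "length (nb u) < i" by (auto simp: nth_opt_def split: if_splits)
    moreover have "w \<in> set (nb u)" using that by (simp add: arcs_of_def)
    then obtain l where "l < length (nb u)" "w = nb u ! l" by (metis in_set_conv_nth)
    ultimately have "Some w \<in> set (history \<sigma> u)" unfolding i
      by (auto simp: nth_opt_def intro!: image_eqI[of _ _ l])
    then show ?thesis by (simp add: in_set_history known_arcs_def)
  qed
  then show ?thesis using known_arcs_subset[OF assms(1)] by auto
qed

text \<open>A vertex is queried at most once per list entry and once for the end marker.\<close>

lemma valid_log_length_le:
  assumes "valid_log nb \<sigma>" "finite X"
  shows "length (filter (\<lambda>e. fst e \<in> X) \<sigma>) \<le> (\<Sum>u\<in>X. Suc (length (nb u)))"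
proof -
  have "length (filter (\<lambda>e. fst e \<in> X) \<sigma>) = (\<Sum>u\<in>X. length (history \<sigma> u))"
  proof (induction \<sigma>)
    case (Cons e \<sigma>)
    have "(\<Sum>u\<in>X. length (history (e # \<sigma>) u))
        = (\<Sum>u\<in>X. (if fst e = u then 1 else 0) + length (history \<sigma> u))"
      by (intro sum.cong) (auto simp: history_def)
    then show ?case using Cons assms(2) by (simp add: sum.distrib)
  qed (simp add: history_def)
  also have "length (history \<sigma> u) \<le> Suc (length (nb u))" for u
    using assms unfolding valid_log_def by (metis length_map length_upt minus_nat.diff_0)
  then have "(\<Sum>u\<in>X. length (history \<sigma> u)) \<le> (\<Sum>u\<in>X. Suc (length (nb u)))" by (intro sum_mono)
  finally show ?thesis .
qed

lemma next_vertex: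
  assumes "\<not> scanned R \<sigma>"
  shows "next_vertex R \<sigma> \<in> R" "(next_vertex R \<sigma>, None) \<notin> set \<sigma>"
proof -
  have "\<exists>u. u \<in> R \<and> (u, None) \<notin> set \<sigma>" using assms unfolding scanned_def by blast
  from someI_ex[OF this] show "next_vertex R \<sigma> \<in> R" "(next_vertex R \<sigma>, None) \<notin> set \<sigma>"
    unfolding next_vertex_def by auto
qed

lemma valid_log_explored: "valid_log nb \<sigma> \<Longrightarrow> valid_log nb (explored nb sel f \<sigma>)"
proof (induction f arbitrary: \<sigma>)
  case (Suc f)
  show ?case using Suc valid_log_step[OF Suc.prems next_vertex(2)] by (auto simp: Let_def)
qed simp

lemma set_explored: "set \<sigma> \<subseteq> set (explored nb sel f \<sigma>)"
proof (induction f arbitrary: \<sigma>)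
  case (Suc f)
  show ?case using Suc[of "\<sigma> @ [_]"] by (auto simp: Let_def)
qed simp

text \<open>Every step adds a query at a selected vertex, and monotonicity of \<open>sel\<close>
  keeps the earlier ones counted when the selection grows.\<close>

lemma explored_scanned_or_long:
  assumes mono: "\<And>\<sigma> e. sel \<sigma> \<subseteq> sel (\<sigma> @ [e])"
  defines "in_sel \<equiv> \<lambda>\<sigma>. length (filter (\<lambda>e. fst e \<in> sel \<sigma>) \<sigma>)"
  shows "scanned (sel (explored nb sel f \<sigma>)) (explored nb sel f \<sigma>) \<or>
    in_sel \<sigma> + f \<le> in_sel (explored nb sel f \<sigma>)"
proof (induction f arbitrary: \<sigma>)
  case (Suc f)
  show ?case
  proof (cases "scanned (sel \<sigma>) \<sigma>")
    case False
    define u where "u = next_vertex (sel \<sigma>) \<sigma>"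
    let ?s = "\<sigma> @ [(u, nth_opt (nb u) (length (history \<sigma> u)))]"
    have "in_sel \<sigma> \<le> length (filter (\<lambda>e. fst e \<in> sel ?s) \<sigma>)"
      unfolding in_sel_def length_filter_conv_card
      using mono by (intro card_mono) auto
    moreover have "u \<in> sel ?s" using mono next_vertex[OF False] u_def by blast
    ultimately have "in_sel \<sigma> + 1 \<le> in_sel ?s" by (simp add: in_sel_def)
    then show ?thesis using Suc[of ?s] False by (auto simp: Let_def u_def)
  qed simp
qed simp

section \<open>Certificates of deficiency and exhaustive scans\<close>

definition certificate :: "nat \<Rightarrow> nat \<Rightarrow> query_log \<Rightarrow> bool" where
  "certificate n k \<sigma> \<longleftrightarrow> (\<exists>A. scanned A \<sigma> \<and> deficient k (known_arcs \<sigma>) {..<n} A)"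

text \<open>This makes the error one-sided: whatever is rejected contains a genuine deficient set of
  the graph.\<close>

lemma certificate_iff:
  assumes "valid_log nb \<sigma>"
  shows "certificate n k \<sigma> \<longleftrightarrow> (\<exists>A. scanned A \<sigma> \<and> deficient k (arcs_of nb) {..<n} A)"
  unfolding certificate_def deficient_def cut_size_def
  using known_arcs_scanned[OF assms] by metis

definition scan_tree :: "bool \<Rightarrow> nat \<Rightarrow> nat \<Rightarrow> nat set \<Rightarrow> nat \<Rightarrow> decision_tree" where
  "scan_tree out n k S f = explore out (\<lambda>_. S) f [] (\<lambda>\<sigma>. Verdict (\<not> certificate n k \<sigma>))"

lemma num_queries_scan_tree: "num_queries q (scan_tree out n k S f) \<le> f"
  unfolding scan_tree_def using num_queries_explore[of q "\<lambda>\<sigma>. Verdict (\<not> certificate n k \<sigma>)" 0] by simp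

lemma scan_tree_sound:
  assumes "answers_by q out nb" "\<nexists>X. deficient k (arcs_of nb) {..<n} X"
  shows "accepts q (scan_tree out n k S f)"
  unfolding scan_tree_def accepts_explore[OF assms(1)]
  using certificate_iff[OF valid_log_explored[of nb "[]"]] assms(2) by auto

text \<open>The budget exceeds the number of list entries and end markers in \<open>S\<close>, so
  the exploration can only stop with \<open>S\<close> scanned.\<close>

lemma scan_tree_complete:
  assumes "answers_by q out nb" "deficient k (arcs_of nb) {..<n} X" "X \<subseteq> S" "finite S"
    and f: "(\<Sum>u\<in>S. Suc (length (nb u))) < f"
  shows "\<not> accepts q (scan_tree out n k S f)"
proof -
  let ?s = "explored nb (\<lambda>_. S) f []"
  have v: "valid_log nb ?s" by (rule valid_log_explored) simp
  have "scanned S ?s"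
    using explored_scanned_or_long[of "\<lambda>_. S" nb f "[]"] valid_log_length_le[OF v assms(4)] f by auto
  then have "scanned X ?s" using assms(3) unfolding scanned_def by blast
  then have "certificate n k ?s" using certificate_iff[OF v] assms(2) by blast
  then show ?thesis unfolding scan_tree_def accepts_explore[OF assms(1)] by simp
qed

section \<open>Local search\<close>

lemma measure_bind_pmf_of_set:
  assumes "finite S" "S \<noteq> {}"
  shows "measure_pmf.prob (pmf_of_set S \<bind> f) A = (\<Sum>x\<in>S. measure_pmf.prob (f x) A) / card S"
proof -
  have "ennreal (measure_pmf.prob (pmf_of_set S \<bind> f) A)
      = (\<integral>\<^sup>+x. ennreal (measure_pmf.prob (f x) A) \<partial>pmf_of_set S)"
    by (simp add: measure_pmf.emeasure_eq_measure[symmetric])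
  also have "\<dots> = (\<Sum>x\<in>S. ennreal (measure_pmf.prob (f x) A)) / card S"
    using assms by (subst nn_integral_pmf_of_set) auto
  also have "\<dots> = ennreal ((\<Sum>x\<in>S. measure_pmf.prob (f x) A) / card S)"
    using assms by (simp add: sum_nonneg divide_ennreal ennreal_of_nat_eq_real_of_nat card_gt_0_iff)
  finally show ?thesis
    by (subst (asm) ennreal_inj) (auto intro!: divide_nonneg_nonneg sum_nonneg)
qed

text \<open>Splits off the first index, for an induction along the search although all indices are
  drawn in advance.\<close>

lemma measure_replicate_pmf_Suc:
  assumes "finite S" "S \<noteq> {}"
  shows "measure_pmf.prob (replicate_pmf (Suc m) (pmf_of_set S)) A
    = (\<Sum>x\<in>S. measure_pmf.prob (replicate_pmf m (pmf_of_set S)) {xs. x # xs \<in> A}) / card S"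
proof -
  have "replicate_pmf (Suc m) (pmf_of_set S)
      = pmf_of_set S \<bind> (\<lambda>x. map_pmf (Cons x) (replicate_pmf m (pmf_of_set S)))"
    by (simp add: map_pmf_def)
  then show ?thesis by (simp only: measure_bind_pmf_of_set[OF assms] measure_map_pmf vimage_def)
qed

text \<open>The intersection of all sets containing \<open>x\<close> whose known cut is saturated by paths from \<open>x\<close> to the
  end points \<open>us\<close>, that is, the set of vertices reachable from \<open>x\<close> in the residual graph of
  these paths. Working with cuts instead of paths avoids residual graphs.\<close>

definition residual_region :: "nat \<Rightarrow> nat \<Rightarrow> nat list \<Rightarrow> query_log \<Rightarrow> nat set" where
  "residual_region n x us \<sigma> =
     \<Inter>{A. x \<in> A \<and> A \<subseteq> {..<n} \<and> cut_size (known_arcs \<sigma>) A \<le> length (filter (\<lambda>u. u \<notin> A) us)}"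

text \<open>By Menger's theorem this is the existence of arc-disjoint paths of known arcs from
  \<open>x\<close> to the entries of \<open>us\<close>, counted with multiplicity.\<close>

definition routable :: "nat \<Rightarrow> nat \<Rightarrow> nat list \<Rightarrow> query_log \<Rightarrow> bool" where
  "routable n x us \<sigma> \<longleftrightarrow>
     (\<forall>A \<subseteq> {..<n}. x \<in> A \<longrightarrow> length (filter (\<lambda>u. u \<notin> A) us) \<le> cut_size (known_arcs \<sigma>) A)"

lemma known_arcs_mono: "set \<sigma> \<subseteq> set \<sigma>' \<Longrightarrow> known_arcs \<sigma> \<subseteq> known_arcs \<sigma>'"
  unfolding known_arcs_def by auto

lemma routable_mono: "routable n x us \<sigma> \<Longrightarrow> set \<sigma> \<subseteq> set \<sigma>' \<Longrightarrow> routable n x us \<sigma>'"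
  unfolding routable_def
  using cut_size_mono[OF finite_known_arcs known_arcs_mono] le_trans by meson

text \<open>New arcs only enlarge cuts, so fewer sets remain saturated and their intersection
  grows.\<close>

lemma residual_region_mono: "residual_region n x us \<sigma> \<subseteq> residual_region n x us (\<sigma> @ [e])"
proof -
  have "cut_size (known_arcs \<sigma>) A \<le> cut_size (known_arcs (\<sigma> @ [e])) A" for A
    by (intro cut_size_mono known_arcs_mono finite_known_arcs) auto
  then show ?thesis unfolding residual_region_def using le_trans by (intro Inter_anti_mono) blast
qed

text \<open>No set that contains \<open>x\<close> and misses \<open>u\<close> is saturated, so each
  has room for one more path.\<close>

lemma routable_snoc:
  assumes "routable n x us \<sigma>" "u \<in> residual_region n x us \<sigma>"
  shows "routable n x (us @ [u]) \<sigma>"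
  unfolding routable_def
proof (intro allI impI)
  fix A assume A: "A \<subseteq> {..<n}" "x \<in> A"
  have "length (filter (\<lambda>u. u \<notin> A) us) \<le> cut_size (known_arcs \<sigma>) A"
    using assms A unfolding routable_def by blast
  moreover have "\<not> cut_size (known_arcs \<sigma>) A \<le> length (filter (\<lambda>u. u \<notin> A) us)" if "u \<notin> A"
    using assms A that unfolding residual_region_def by blast
  ultimately show "length (filter (\<lambda>u. u \<notin> A) (us @ [u])) \<le> cut_size (known_arcs \<sigma>) A" by auto
qed

lemma length_filter_not_Int_Un:
  "length (filter (\<lambda>u. u \<notin> A) us) + length (filter (\<lambda>u. u \<notin> B) us)
    = length (filter (\<lambda>u. u \<notin> A \<inter> B) us) + length (filter (\<lambda>u. u \<notin> A \<union> B) us)"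
  by (induction us) auto

text \<open>Cut size minus the number of end points outside is submodular and, by routability,
  nonnegative on sets containing \<open>x\<close>. Its zeros are therefore closed under
  intersection, and the region is itself saturated.\<close>

lemma residual_region_saturated:
  assumes "routable n x us \<sigma>" "x < n" "known_arcs \<sigma> \<subseteq> {..<n} \<times> {..<n}"
  defines "R \<equiv> residual_region n x us \<sigma>"
  shows "x \<in> R" "R \<subseteq> {..<n}" "cut_size (known_arcs \<sigma>) R \<le> length us"
proof -
  define T where
    "T = {A. x \<in> A \<and> A \<subseteq> {..<n} \<and> cut_size (known_arcs \<sigma>) A \<le> length (filter (\<lambda>u. u \<notin> A) us)}"
  have "known_arcs \<sigma> \<inter> {..<n} \<times> - {..<n} = {}" using assms(3) by auto
  then have "{..<n} \<in> T" using assms(2) by (simp add: T_def cut_size_def)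
  have inter: "A \<inter> B \<in> T" if AB: "A \<in> T" "B \<in> T" for A B
  proof -
    have "length (filter (\<lambda>u. u \<notin> A \<union> B) us) \<le> cut_size (known_arcs \<sigma>) (A \<union> B)"
      using assms(1)[unfolded routable_def, rule_format, of "A \<union> B"] AB unfolding T_def by simp
    moreover have "cut_size (known_arcs \<sigma>) (A \<inter> B) + cut_size (known_arcs \<sigma>) (A \<union> B)
        \<le> cut_size (known_arcs \<sigma>) A + cut_size (known_arcs \<sigma>) B"
      by (rule cut_size_submodular) simp
    ultimately have "cut_size (known_arcs \<sigma>) (A \<inter> B) \<le> length (filter (\<lambda>u. u \<notin> A \<inter> B) us)"
      using AB length_filter_not_Int_Un[of A us B] unfolding T_def by simp
    then show ?thesis using AB unfolding T_def by auto
  qed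
  have "finite T" by (rule finite_subset[of _ "Pow {..<n}"]) (auto simp: T_def)
  then have "\<Inter>T' \<in> T" if "T' \<subseteq> T" "T' \<noteq> {}" for T'
  proof -
    have "finite T'" using \<open>finite T\<close> that finite_subset by blast
    from this that(2,1) show ?thesis by (induction rule: finite_ne_induct) (auto intro: inter)
  qed
  from this[of T] have "\<Inter>T \<in> T" using \<open>{..<n} \<in> T\<close> by blast
  then have "R \<in> T" unfolding R_def residual_region_def T_def .
  then show "x \<in> R" "R \<subseteq> {..<n}" unfolding T_def by auto
  have "cut_size (known_arcs \<sigma>) R \<le> length (filter (\<lambda>u. u \<notin> R) us)"
    using \<open>R \<in> T\<close> unfolding T_def by simp
  also have "\<dots> \<le> length us" by simp
  finally show "cut_size (known_arcs \<sigma>) R \<le> length us" .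
qed

text \<open>End points are drawn from slots rather than vertices: a set can then be hit only in
  proportion to its volume, end markers included.\<close>

definition slots_in :: "nat set \<Rightarrow> query_log \<Rightarrow> query_log" where
  "slots_in R \<sigma> = filter (\<lambda>e. fst e \<in> R) \<sigma>"

text \<open>If an exploration gets stuck, the list access \<open>! r\<close> may be out of range. The log then already
  contains a certificate, so the end point does not matter.\<close>

primrec local_tree ::
  "bool \<Rightarrow> nat \<Rightarrow> nat \<Rightarrow> nat \<Rightarrow> nat \<Rightarrow> nat list \<Rightarrow> query_log \<Rightarrow> nat list \<Rightarrow> decision_tree"
where
  "local_tree out n k x Q [] \<sigma> us = Verdict (\<not> certificate n k \<sigma>)"
| "local_tree out n k x Q (r # rs) \<sigma> us =
     explore out (residual_region n x us) Q \<sigma> (\<lambda>\<sigma>'.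
       local_tree out n k x Q rs \<sigma>' (us @ [fst (slots_in (residual_region n x us \<sigma>') \<sigma>' ! r)]))"

primrec local_log ::
  "(nat \<Rightarrow> nat list) \<Rightarrow> nat \<Rightarrow> nat \<Rightarrow> nat \<Rightarrow> nat list \<Rightarrow> query_log \<Rightarrow> nat list \<Rightarrow> query_log"
where
  "local_log nb n x Q [] \<sigma> us = \<sigma>"
| "local_log nb n x Q (r # rs) \<sigma> us =
     (let \<sigma>' = explored nb (residual_region n x us) Q \<sigma> in
       local_log nb n x Q rs \<sigma>' (us @ [fst (slots_in (residual_region n x us \<sigma>') \<sigma>' ! r)]))"

lemma accepts_local_tree:
  assumes "answers_by q out nb"
  shows "accepts q (local_tree out n k x Q rs \<sigma> us) \<longleftrightarrow> \<not> certificate n k (local_log nb n x Q rs \<sigma> us)"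
  by (induction rs arbitrary: \<sigma> us) (simp_all add: accepts_explore[OF assms] Let_def)

lemma num_queries_local_tree:
  "num_queries q (local_tree out n k x Q rs \<sigma> us) \<le> length rs * Q"
proof (induction rs arbitrary: \<sigma> us)
  case (Cons r rs)
  show ?case unfolding local_tree.simps
    using num_queries_explore[OF Cons, where f = Q] by simp
qed simp

lemma local_log_extends:
  assumes "valid_log nb \<sigma>"
  shows "valid_log nb (local_log nb n x Q rs \<sigma> us)" "set \<sigma> \<subseteq> set (local_log nb n x Q rs \<sigma> us)"
  using assms
proof (induction rs arbitrary: \<sigma> us)
  case (Cons r rs)
  { case 1 then show ?case using Cons(1) valid_log_explored by (simp add: Let_def) }
  { case 2
    then show ?case
      unfolding local_log.simps Let_def by (intro order_trans[OF set_explored Cons(2)] valid_log_explored) }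
qed simp_all

lemma certificate_mono:
  assumes "valid_log nb \<sigma>" "valid_log nb \<sigma>'" "set \<sigma> \<subseteq> set \<sigma>'" "certificate n k \<sigma>"
  shows "certificate n k \<sigma>'"
  using assms(3,4) unfolding certificate_iff[OF assms(1)] certificate_iff[OF assms(2)]
  by (auto simp: scanned_def)

text \<open>Every end point outside \<open>X\<close> uses up one arc leaving \<open>X\<close>, so fewer than \<open>k\<close> of them can
  be found. At most \<open>\<nu>\<close> of the \<open>Q\<close> slots from which an end point is drawn have their tail in
  \<open>X\<close>, and an exploration that gets stuck exhibits a deficient set.\<close>

lemma local_log_fails:
  assumes nb: "arcs_of nb \<subseteq> {..<n} \<times> {..<n}"
    and X: "deficient k (arcs_of nb) {..<n} X" "x \<in> X" "(\<Sum>u\<in>X. Suc (length (nb u))) \<le> \<nu>"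
    and Q: "Q > 0"
    and "valid_log nb \<sigma>" "routable n x us \<sigma>" "set us \<inter> X = {}" "length us + m = k"
  shows "measure_pmf.prob (replicate_pmf m (pmf_of_set {..<Q}))
      {rs. \<not> certificate n k (local_log nb n x Q rs \<sigma> us)} \<le> m * \<nu> / Q"
  using assms(6-9)
proof (induction m arbitrary: \<sigma> us)
  case 0
  \<comment> \<open>With no draws left, \<open>k\<close> end points outside \<open>X\<close> would
    require \<open>k\<close> arcs leaving \<open>X\<close>.\<close>
  have "filter (\<lambda>u. u \<notin> X) us = us" using 0 by (intro filter_True) auto
  then have "k \<le> cut_size (known_arcs \<sigma>) X"
    using 0 X unfolding routable_def deficient_def by (metis add_0_right psubset_imp_subset)
  also have "finite (arcs_of nb)" using nb finite_subset by blast
  then have "cut_size (known_arcs \<sigma>) X \<le> cut_size (arcs_of nb) X"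
    using known_arcs_subset[OF 0(1)] by (rule cut_size_mono)
  finally show ?case using X by (simp add: deficient_def)
next
  case (Suc m)
  have finX: "finite X" "x < n" using X unfolding deficient_def by (auto intro: finite_subset)
  define s where "s = explored nb (residual_region n x us) Q \<sigma>"
  define R where "R = residual_region n x us s"
  have s: "valid_log nb s" "set \<sigma> \<subseteq> set s"
    unfolding s_def using Suc.prems by (auto intro!: valid_log_explored set_explored)
  have feas: "routable n x us s" using Suc.prems s by (blast intro: routable_mono)
  have known: "known_arcs s \<subseteq> {..<n} \<times> {..<n}" using known_arcs_subset[OF s(1)] nb by blast
  note R = residual_region_saturated[OF feas finX(2) known, folded R_def]
  let ?us = "\<lambda>r. us @ [fst (slots_in R s ! r)]"
  let ?P = "\<lambda>r. measure_pmf.prob (replicate_pmf m (pmf_of_set {..<Q}))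
      {rs. \<not> certificate n k (local_log nb n x Q rs s (?us r))}"
  have prob: "measure_pmf.prob (replicate_pmf (Suc m) (pmf_of_set {..<Q}))
      {rs. \<not> certificate n k (local_log nb n x Q rs \<sigma> us)} = (\<Sum>r<Q. ?P r) / Q"
    using Q by (subst measure_replicate_pmf_Suc) (auto simp: Let_def s_def R_def lessThan_empty_iff)
  have "(\<Sum>r<Q. ?P r) \<le> real (Suc m) * real \<nu>"
  proof (cases "scanned R s")
    case True
    have "certificate n k s"
    \<comment> \<open>The region has at most \<open>length us < k\<close> leaving arcs, but it may
      be the whole vertex set; then \<open>X\<close> has been scanned and is the
      certificate.\<close>
    proof (cases "R = {..<n}")
      case True
      with \<open>scanned R s\<close> have "scanned X s" using X unfolding scanned_def deficient_def by blast
      with X show ?thesis unfolding certificate_iff[OF s(1)] by blast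
    next
      case False
      then have "deficient k (known_arcs s) {..<n} R"
        using R Suc.prems unfolding deficient_def by auto
      with True show ?thesis unfolding certificate_def by blast
    qed
    then have "certificate n k (local_log nb n x Q rs s us')" for rs us'
      using certificate_mono[OF s(1)] local_log_extends[OF s(1)] by blast
    then show ?thesis by simp
  next
    case False
    have len: "Q \<le> length (slots_in R s)"
      using explored_scanned_or_long[of "residual_region n x us" nb Q \<sigma>, OF residual_region_mono] False
      unfolding slots_in_def R_def s_def by simp
    define bad where "bad = {r. r < Q \<and> fst (slots_in R s ! r) \<in> X}"
    have "card bad \<le> length (filter (\<lambda>e. fst e \<in> X) (slots_in R s))"
      unfolding length_filter_conv_card using len by (intro card_mono) (auto simp: bad_def)
    also have "\<dots> \<le> length (filter (\<lambda>e. fst e \<in> X) s)"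
      unfolding slots_in_def filter_filter length_filter_conv_card by (intro card_mono) auto
    also have "\<dots> \<le> \<nu>" using valid_log_length_le[OF s(1) finX(1)] X(3) by (rule le_trans)
    finally have bad: "card bad \<le> \<nu>" .
    \<comment> \<open>A union bound over the draws: an end point in \<open>X\<close> is charged
      fully, any other keeps the paths routable and \<open>X\<close> avoided, so the induction
      hypothesis applies.\<close>
    have "?P r \<le> of_bool (r \<in> bad) + real m * real \<nu> / Q" if "r < Q" for r
    proof (cases "r \<in> bad")
      case True
      then show ?thesis by (auto intro: order_trans[OF measure_pmf.prob_le_1])
    next
      case False
      have "slots_in R s ! r \<in> set (slots_in R s)" using that len by (intro nth_mem) simp
      then have "fst (slots_in R s ! r) \<in> R" unfolding slots_in_def by simp
      then have "routable n x (?us r) s" unfolding R_def by (intro routable_snoc feas)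
      moreover have "set (?us r) \<inter> X = {}" using False Suc.prems that unfolding bad_def by auto
      ultimately have "?P r \<le> real m * real \<nu> / Q" using Suc.prems s by (intro Suc.IH) auto
      then show ?thesis by simp
    qed
    then have "(\<Sum>r<Q. ?P r) \<le> (\<Sum>r<Q. of_bool (r \<in> bad) + real m * real \<nu> / Q)" by (intro sum_mono) simp
    also have "\<dots> = card bad + real m * real \<nu>"
      using Q by (simp add: sum.distrib of_bool_def sum.If_cases bad_def Int_def)
    also have "\<dots> \<le> real (Suc m) * real \<nu>" using bad by (simp add: distrib_right)
    finally show ?thesis .
  qed
  then show ?case unfolding prob by (intro divide_right_mono) simp_all
qed

definition local_tester :: "bool \<Rightarrow> nat \<Rightarrow> nat \<Rightarrow> nat \<Rightarrow> nat \<Rightarrow> randomized_algorithm" where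
  "local_tester out n k Q x =
     map_pmf (\<lambda>rs. local_tree out n k x Q rs [] []) (replicate_pmf k (pmf_of_set {..<Q}))"

text \<open>Each of the \<open>k\<close> draws falls into \<open>X\<close> with probability at most
  \<nu> / Q; the choice Q = 3 k \<nu> brings the total down to 1/3.\<close>

lemma local_tester_complete:
  assumes "answers_by q out nb" "arcs_of nb \<subseteq> {..<n} \<times> {..<n}"
    and X: "deficient k (arcs_of nb) {..<n} X" "x \<in> X" "(\<Sum>u\<in>X. Suc (length (nb u))) \<le> \<nu>"
  shows "accept_prob q (local_tester out n k (3 * k * \<nu>) x) \<le> 1 / 3"
proof -
  have "k > 0" using X by (auto simp: deficient_def)
  have "finite X" using X unfolding deficient_def by (auto intro: finite_subset)
  then have "\<nu> > 0" using X by (cases "\<nu> = 0") auto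
  have "accept_prob q (local_tester out n k (3 * k * \<nu>) x) \<le> k * \<nu> / (3 * k * \<nu>)"
    unfolding accept_prob_def local_tester_def measure_map_pmf vimage_def mem_Collect_eq
      accepts_local_tree[OF assms(1)]
    using \<open>k > 0\<close> \<open>\<nu> > 0\<close> local_log_fails[OF assms(2) X, of "3 * k * \<nu>" "[]" "[]" k]
    by (simp add: routable_def)
  then show ?thesis using \<open>k > 0\<close> \<open>\<nu> > 0\<close> by simp
qed

section \<open>Sampling\<close>

primrec andthen :: "decision_tree \<Rightarrow> decision_tree \<Rightarrow> decision_tree" where
  "andthen (Verdict b) T = (if b then T else Verdict False)"
| "andthen (Query x c) T = Query x (\<lambda>a. andthen (c a) T)"

lemma accepts_andthen: "accepts q (andthen T T') \<longleftrightarrow> accepts q T \<and> accepts q T'"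
  by (induction T) auto

lemma num_queries_andthen: "num_queries q (andthen T T') \<le> num_queries q T + num_queries q T'"
  by (induction T) auto

definition both :: "randomized_algorithm \<Rightarrow> randomized_algorithm \<Rightarrow> randomized_algorithm" where
  "both A B = A \<bind> (\<lambda>T. map_pmf (andthen T) B)"

primrec all_of :: "(nat \<Rightarrow> randomized_algorithm) \<Rightarrow> nat \<Rightarrow> randomized_algorithm" where
  "all_of f 0 = return_pmf (Verdict True)"
| "all_of f (Suc j) = both (all_of f j) (f (Suc j))"

lemma accept_prob_return: "accept_prob q (return_pmf T) = (if accepts q T then 1 else 0)"
  by (simp add: accept_prob_def indicator_def)

lemma accept_prob_nonneg: "0 \<le> accept_prob q A" and accept_prob_le_1: "accept_prob q A \<le> 1"
  by (simp_all add: accept_prob_def)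

lemma reject_prob_eq: "reject_prob q A = 1 - accept_prob q A"
  unfolding reject_prob_def accept_prob_def
  by (subst measure_pmf.prob_compl[symmetric]) (auto intro: arg_cong[where f = "measure_pmf.prob A"])

lemma accept_prob_both: "accept_prob q (both A B) = accept_prob q A * accept_prob q B"
proof -
  let ?S = "{T. accepts q T}"
  have "ennreal (accept_prob q (both A B)) = (\<integral>\<^sup>+T. emeasure B {T'. accepts q (andthen T T')} \<partial>A)"
    unfolding accept_prob_def both_def
    by (simp add: measure_pmf.emeasure_eq_measure[symmetric] vimage_def)
  also have "\<dots> = (\<integral>\<^sup>+T. indicator ?S T * emeasure B ?S \<partial>A)"
    by (intro nn_integral_cong) (auto simp: accepts_andthen indicator_def)
  also have "\<dots> = emeasure A ?S * emeasure B ?S" by (simp add: nn_integral_multc)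
  also have "\<dots> = ennreal (accept_prob q A * accept_prob q B)"
    by (simp add: accept_prob_def measure_pmf.emeasure_eq_measure ennreal_mult)
  finally show ?thesis by (simp add: accept_prob_nonneg)
qed

lemma accept_prob_both_le:
  "accept_prob q (both A B) \<le> accept_prob q A" "accept_prob q (both A B) \<le> accept_prob q B"
  unfolding accept_prob_both
  by (simp_all add: mult_left_le mult_left_le_one_le accept_prob_nonneg accept_prob_le_1)

lemma accept_prob_all_of: "accept_prob q (all_of f J) = (\<Prod>j=1..J. accept_prob q (f j))"
  by (induction J) (simp_all add: accept_prob_return accept_prob_both)

definition always_accepts :: "query_access \<Rightarrow> randomized_algorithm \<Rightarrow> bool" where
  "always_accepts q A \<longleftrightarrow> (\<forall>T\<in>set_pmf A. accepts q T)"

lemma accept_prob_eq_1: "always_accepts q A \<Longrightarrow> accept_prob q A = 1"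
  unfolding always_accepts_def accept_prob_def
  by (subst measure_pmf.prob_eq_1) (auto simp: AE_measure_pmf_iff)

lemma always_accepts_both: "always_accepts q A \<Longrightarrow> always_accepts q B \<Longrightarrow> always_accepts q (both A B)"
  by (auto simp: always_accepts_def both_def accepts_andthen)

lemma always_accepts_all_of: "(\<And>j. always_accepts q (f j)) \<Longrightarrow> always_accepts q (all_of f J)"
  by (induction J) (auto intro: always_accepts_both simp: always_accepts_def[of _ "return_pmf _"])

text \<open>Ranges over all query accesses, since exploration budgets bound the queries whatever the
  answers are.\<close>

definition queries_at_most :: "randomized_algorithm \<Rightarrow> nat \<Rightarrow> bool" where
  "queries_at_most A t \<longleftrightarrow> (\<forall>q. \<forall>T\<in>set_pmf A. num_queries q T \<le> t)"

lemma queries_at_most_both: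
  "queries_at_most A s \<Longrightarrow> queries_at_most B t \<Longrightarrow> queries_at_most (both A B) (s + t)"
  unfolding queries_at_most_def both_def
  by (auto intro!: order_trans[OF num_queries_andthen] add_mono)

lemma queries_at_most_all_of:
  "(\<And>j. queries_at_most (f j) (t j)) \<Longrightarrow> queries_at_most (all_of f J) (\<Sum>j=1..J. t j)"
proof (induction J)
  case (Suc J)
  then show ?case using queries_at_most_both[of "all_of f J" _ "f (Suc J)"] by simp
qed (simp add: queries_at_most_def)

text \<open>The sets sought are singletons or have more than \<open>k\<close> vertices. A deficient
  vertex has at most \<open>k - 1\<close> out-neighbours besides itself and perhaps a loop; with the
  end marker this makes \<open>k + 1\<close> queries, strictly below the budget
  \<open>k + 2\<close>.\<close>

definition vertex_test :: "bool \<Rightarrow> nat \<Rightarrow> nat \<Rightarrow> (nat \<Rightarrow> nat) \<Rightarrow> nat \<Rightarrow> nat \<Rightarrow> randomized_algorithm" where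
  "vertex_test out n k \<nu> s v =
     both (return_pmf (scan_tree out n k {v} (k + 2)))
       (if k < s then local_tester out n k (3 * k * \<nu> s) v else return_pmf (Verdict True))"

definition sample_test :: "bool \<Rightarrow> nat \<Rightarrow> nat \<Rightarrow> (nat \<Rightarrow> nat) \<Rightarrow> nat \<Rightarrow> randomized_algorithm" where
  "sample_test out n k \<nu> s = pmf_of_set {..<n} \<bind> vertex_test out n k \<nu> s"

text \<open>The \<open>j\<close>-th sample only looks for sets of at most \<open>R div j\<close> vertices. A set \<open>X\<close> is thus sought by
  \<open>R div card X\<close> samples, each of which hits it with probability \<open>card X / n\<close>, so that all sets
  have about the same chance of being hit.\<close>

definition sampler :: "nat \<Rightarrow> nat \<Rightarrow> (nat \<Rightarrow> nat) \<Rightarrow> nat \<Rightarrow> randomized_algorithm" where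
  "sampler n k \<nu> R =
     all_of (\<lambda>j. both (sample_test True n k \<nu> (R div j)) (sample_test False n k \<nu> (R div j))) R"

lemma queries_at_most_sampler:
  assumes "n \<ge> 1" "k \<ge> 1" "\<And>s. k < s \<Longrightarrow> \<nu> s > 0"
  shows "queries_at_most (sampler n k \<nu> R)
    (\<Sum>j=1..R. 2 * (k + 2 + (if k < R div j then 3 * k * k * \<nu> (R div j) else 0)))"
proof -
  let ?t = "\<lambda>s. k + 2 + (if k < s then 3 * k * k * \<nu> s else 0)"
  have "queries_at_most (vertex_test out n k \<nu> s v) (?t s)" for out s v
    unfolding vertex_test_def
  proof (rule queries_at_most_both)
    show "queries_at_most (return_pmf (scan_tree out n k {v} (k + 2))) (k + 2)"
      by (simp add: queries_at_most_def num_queries_scan_tree del: add_2_eq_Suc')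
    have "num_queries q (local_tree out n k v (3 * k * \<nu> s) rs [] []) \<le> 3 * k * k * \<nu> s"
      if "length rs = k" for q rs
      using num_queries_local_tree[of q out n k v "3 * k * \<nu> s" rs] that by (simp add: algebra_simps)
    then show "queries_at_most
        (if k < s then local_tester out n k (3 * k * \<nu> s) v else return_pmf (Verdict True))
        (if k < s then 3 * k * k * \<nu> s else 0)"
      by (auto simp: queries_at_most_def local_tester_def set_replicate_pmf)
  qed
  then have "queries_at_most (sample_test out n k \<nu> s) (?t s)" for out s
    unfolding sample_test_def queries_at_most_def by simp
  from queries_at_most_both[OF this this] show ?thesis
    unfolding sampler_def mult_2 by (rule queries_at_most_all_of)
qed

lemma always_accepts_sample_test:
  assumes "answers_by q out nb" "\<nexists>X. deficient k (arcs_of nb) {..<n} X"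
  shows "always_accepts q (sample_test out n k \<nu> s)"
proof -
  have "always_accepts q (local_tester out n k Q v)" for Q v
    using assms(2) unfolding always_accepts_def local_tester_def
    by (auto simp: accepts_local_tree[OF assms(1)] certificate_iff[OF local_log_extends(1)[OF valid_log_Nil]])
  then have "always_accepts q (vertex_test out n k \<nu> s v)" for v
    unfolding vertex_test_def using scan_tree_sound[OF assms]
    by (intro always_accepts_both) (auto simp: always_accepts_def)
  then show ?thesis unfolding sample_test_def always_accepts_def by simp
qed

lemma vertex_test_complete:
  assumes "answers_by q out nb" "arcs_of nb \<subseteq> {..<n} \<times> {..<n}" "\<And>u. distinct (nb u)"
    and X: "deficient k (arcs_of nb) {..<n} X" "x \<in> X" "card X = 1 \<or> k < card X" "card X \<le> s"
    and vol: "k < card X \<Longrightarrow> (\<Sum>u\<in>X. Suc (length (nb u))) \<le> \<nu> s"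
  shows "accept_prob q (vertex_test out n k \<nu> s x) \<le> 1 / 3"
proof (cases "k < card X")
  case True
  then have "accept_prob q (local_tester out n k (3 * k * \<nu> s) x) \<le> 1 / 3"
    using local_tester_complete[OF assms(1,2) X(1,2) vol] by blast
  moreover have "k < s" using True X(4) by simp
  ultimately show ?thesis unfolding vertex_test_def if_P[OF \<open>k < s\<close>]
    by (intro order_trans[OF accept_prob_both_le(2)])
next
  case False
  then have X_eq: "X = {x}" using X by (metis card_1_singletonE singletonD)
  have "length (nb x) = card (set (nb x))" using assms(3) by (simp add: distinct_card)
  \<comment> \<open>A loop occupies a list entry but is not in the cut.\<close>
  also have "\<dots> \<le> card (insert x (snd ` (arcs_of nb \<inter> {x} \<times> - {x})))"
  proof (rule card_mono)
    show "set (nb x) \<subseteq> insert x (snd ` (arcs_of nb \<inter> {x} \<times> - {x}))"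
    proof
      fix w assume "w \<in> set (nb x)"
      then have "w \<noteq> x \<Longrightarrow> (x, w) \<in> arcs_of nb \<inter> {x} \<times> - {x}" by (simp add: arcs_of_def)
      then show "w \<in> insert x (snd ` (arcs_of nb \<inter> {x} \<times> - {x}))"
        by (cases "w = x") (auto intro: rev_image_eqI)
    qed
  qed (use finite_subset[OF assms(2)] in auto)
  also have "\<dots> \<le> Suc (card (snd ` (arcs_of nb \<inter> {x} \<times> - {x})))"
    by (rule card_insert_le_m1) auto
  also have "\<dots> \<le> Suc (cut_size (arcs_of nb) {x})"
    unfolding cut_size_def using finite_subset[OF assms(2)] by (auto intro: card_image_le)
  also have "\<dots> \<le> k" using X(1) unfolding X_eq deficient_def by simp
  finally have "\<not> accepts q (scan_tree out n k {x} (k + 2))"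
    using X by (intro scan_tree_complete[OF assms(1) X(1)]) (auto simp: X_eq)
  then have "accept_prob q (return_pmf (scan_tree out n k {x} (k + 2))) = 0"
    by (simp add: accept_prob_return)
  then show ?thesis unfolding vertex_test_def accept_prob_both by simp
qed

section \<open>Hitting a disjoint family of deficient sets\<close>

lemma sum_card_disjoint_family:
  assumes "disjoint F" "\<And>X. X \<in> F \<Longrightarrow> X \<subseteq> V" "finite V"
  shows "(\<Sum>X\<in>F. card X) = card (\<Union>F)" "(\<Sum>X\<in>F. card X) \<le> card V"
proof -
  have "finite X" if "X \<in> F" for X using assms that finite_subset by blast
  then show eq: "(\<Sum>X\<in>F. card X) = card (\<Union>F)"
    using assms(1) by (intro card_Union_disjoint[symmetric]) (auto simp: disjoint_def pairwise_def disjnt_def)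
  show "(\<Sum>X\<in>F. card X) \<le> card V" unfolding eq using assms by (intro card_mono) auto
qed

text \<open>The chances of hitting disjoint sets add up, and a hit leads to rejection with
  probability at least 2/3.\<close>

lemma sample_test_complete:
  assumes "answers_by q out nb" "arcs_of nb \<subseteq> {..<n} \<times> {..<n}" "\<And>u. distinct (nb u)" "n \<ge> 1"
    and F: "\<And>X. X \<in> F \<Longrightarrow> deficient k (arcs_of nb) {..<n} X" "disjoint F"
      "\<And>X. X \<in> F \<Longrightarrow> card X = 1 \<or> k < card X"
    and vol: "\<And>X. deficient k (arcs_of nb) {..<n} X \<Longrightarrow> k < card X \<Longrightarrow> card X \<le> s \<Longrightarrow>
      (\<Sum>u\<in>X. Suc (length (nb u))) \<le> \<nu> s"
  shows "accept_prob q (sample_test out n k \<nu> s) \<le> 1 - 2 / 3 * (\<Sum>X\<in>{X\<in>F. card X \<le> s}. card X) / n"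
proof -
  let ?F = "{X\<in>F. card X \<le> s}"
  have sub: "X \<subseteq> {..<n}" if "X \<in> F" for X using F(1)[OF that] by (auto simp: deficient_def)
  have "accept_prob q (sample_test out n k \<nu> s)
      = (\<Sum>v<n. accept_prob q (vertex_test out n k \<nu> s v)) / n"
    unfolding accept_prob_def sample_test_def
    using assms(4) by (subst measure_bind_pmf_of_set) (auto simp: lessThan_empty_iff)
  also have "(\<Sum>v<n. accept_prob q (vertex_test out n k \<nu> s v)) \<le> (\<Sum>v<n. 1 - 2 / 3 * of_bool (v \<in> \<Union>?F))"
  proof (rule sum_mono)
    fix v
    show "accept_prob q (vertex_test out n k \<nu> s v) \<le> 1 - 2 / 3 * of_bool (v \<in> \<Union>?F)"
    proof (cases "v \<in> \<Union>?F")
      case True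
      then obtain X where X: "X \<in> F" "card X \<le> s" "v \<in> X" by blast
      have "accept_prob q (vertex_test out n k \<nu> s v) \<le> 1 / 3"
        by (rule vertex_test_complete[OF assms(1-3) F(1)[OF X(1)] X(3) F(3)[OF X(1)] X(2)])
          (use vol F(1) X in blast)
      then show ?thesis using True by simp
    qed (simp add: accept_prob_le_1)
  qed
  also have "\<dots> = n - 2 / 3 * card (\<Union>?F)"
  proof -
    have "{..<n} \<inter> \<Union>?F = \<Union>?F" using sub by blast
    moreover have "(\<Sum>v<n. of_bool (v \<in> U)) = (card ({..<n} \<inter> U) :: real)" for U
      by (simp add: of_bool_def sum.If_cases)
    ultimately show ?thesis by (simp only: sum_subtractf sum_distrib_left[symmetric]) simp
  qed
  also have "card (\<Union>?F) = (\<Sum>X\<in>?F. card X)"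
    using F(2) sub by (intro sum_card_disjoint_family(1)[of _ "{..<n}", symmetric]) (auto simp: disjoint_def)
  finally show ?thesis using assms(4) by (simp add: divide_simps split: if_splits)
qed

text \<open>Double counting: \<open>X\<close> is within the size bound of exactly
  \<open>R div card X\<close> samples. Rounding loses less than \<open>card X\<close> per set, hence
  at most \<open>n\<close> over a disjoint family.\<close>

lemma sampler_weight:
  assumes "disjoint F" "\<And>X. X \<in> F \<Longrightarrow> X \<noteq> {} \<and> X \<subseteq> {..<n}"
  shows "R * card F \<le> 2 * (\<Sum>j=1..R. \<Sum>X\<in>{X\<in>F. card X \<le> R div j}. card X) + n"
proof -
  have finF: "finite F" by (rule finite_subset[of _ "Pow {..<n}"]) (use assms in auto)
  have pos: "card X > 0" if "X \<in> F" for X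
    using assms(2)[OF that] finite_subset by (fastforce simp: card_gt_0_iff)
  have "(\<Sum>j=1..R. \<Sum>X\<in>{X\<in>F. card X \<le> R div j}. card X)
      = (\<Sum>j=1..R. \<Sum>X\<in>F. if card X \<le> R div j then card X else 0)"
    using finF by (simp add: sum.inter_filter)
  also have "\<dots> = (\<Sum>X\<in>F. \<Sum>j=1..R. if card X \<le> R div j then card X else 0)" by (rule sum.swap)
  also have "\<dots> = (\<Sum>X\<in>F. (R div card X) * card X)"
  proof (rule sum.cong[OF refl])
    fix X assume X: "X \<in> F"
    have iff: "card X \<le> R div j \<longleftrightarrow> j \<le> R div card X" if "j \<ge> 1" for j
      using that pos[OF X] by (simp add: less_eq_div_iff_mult_less_eq mult.commute)
    have "{j \<in> {1..R}. card X \<le> R div j} = {1..R div card X}"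
    proof (rule set_eqI)
      fix j
      show "j \<in> {j \<in> {1..R}. card X \<le> R div j} \<longleftrightarrow> j \<in> {1..R div card X}"
        using iff[of j] by (cases "j \<ge> 1") (auto intro: order_trans[OF _ div_le_dividend])
    qed
    then show "(\<Sum>j=1..R. if card X \<le> R div j then card X else 0) = (R div card X) * card X"
      by (simp add: sum.inter_filter[symmetric])
  qed
  finally have eq: "(\<Sum>j=1..R. \<Sum>X\<in>{X\<in>F. card X \<le> R div j}. card X) = (\<Sum>X\<in>F. (R div card X) * card X)" .
  have "R * card F = (\<Sum>X\<in>F. R)" by simp
  also have "\<dots> \<le> (\<Sum>X\<in>F. 2 * ((R div card X) * card X) + card X)"
  proof (rule sum_mono)
    fix X assume X: "X \<in> F"
    have "R = (R div card X) * card X + R mod card X" by simp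
    moreover have "R mod card X < card X" using pos[OF X] by simp
    ultimately show "R \<le> 2 * ((R div card X) * card X) + card X" by linarith
  qed
  also have "\<dots> = 2 * (\<Sum>X\<in>F. (R div card X) * card X) + (\<Sum>X\<in>F. card X)"
    by (simp add: sum.distrib sum_distrib_left)
  also have "(\<Sum>X\<in>F. card X) \<le> n"
    using sum_card_disjoint_family(2)[OF assms(1), of "{..<n}"] assms(2) by auto
  finally show ?thesis unfolding eq by simp
qed


text \<open>(1 + 1/3)^4 = 256/81 > 3.\<close>

lemma exp_four_thirds: "exp (- (4 / 3)) \<le> (1 / 3 :: real)"
proof -
  have "3 \<le> (1 + (4 / 3 :: real) / of_nat 4) ^ 4" by (simp add: eval_nat_numeral)
  also have "\<dots> \<le> exp (4 / 3)" by (rule exp_ge_one_plus_x_over_n_power_n) auto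
  finally show ?thesis by (simp add: exp_minus field_simps)
qed

text \<open>The assumption on \<open>R\<close> leaves total weight at least \<open>2 * n\<close>
  after the rounding loss. With 1 - x \<le> exp (-x), acceptance by all samples has probability at
  most exp (- (2/3) 2).\<close>

lemma all_of_samples_complete:
  assumes "answers_by q out nb" "arcs_of nb \<subseteq> {..<n} \<times> {..<n}" "\<And>u. distinct (nb u)" "n \<ge> 1"
    and F: "\<And>X. X \<in> F \<Longrightarrow> deficient k (arcs_of nb) {..<n} X" "disjoint F"
    and vol: "\<And>X s. deficient k (arcs_of nb) {..<n} X \<Longrightarrow> k < card X \<Longrightarrow> card X \<le> s \<Longrightarrow>
      (\<Sum>u\<in>X. Suc (length (nb u))) \<le> \<nu> s"
    and R: "5 * n \<le> R * card F"
  shows "(\<Prod>j=1..R. accept_prob q (sample_test out n k \<nu> (R div j))) \<le> 1 / 3"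
proof -
  obtain F' where F': "\<And>X. X \<in> F' \<Longrightarrow> deficient k (arcs_of nb) {..<n} X \<and> (card X = 1 \<or> k < card X)"
    "disjoint F'" "card F' = card F"
    using small_or_large_deficient_family[of "{..<n}" "arcs_of nb" F k] F assms(2) by auto
  define w where "w j = (\<Sum>X\<in>{X\<in>F'. card X \<le> R div j}. card X)" for j
  have "R * card F' \<le> 2 * (\<Sum>j=1..R. w j) + n"
    unfolding w_def using F' by (intro sampler_weight) (auto simp: deficient_def)
  then have w: "2 * n \<le> (\<Sum>j=1..R. w j)" using R F'(3) by simp
  have "accept_prob q (sample_test out n k \<nu> (R div j)) \<le> exp (- (2 / 3 * w j / n))" for j
  proof -
    have "accept_prob q (sample_test out n k \<nu> (R div j)) \<le> 1 - 2 / 3 * w j / n"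
      unfolding w_def using F' vol by (intro sample_test_complete[OF assms(1-4)]) auto
    also have "\<dots> \<le> exp (- (2 / 3 * w j / n))" using exp_ge_add_one_self[of "- (2 / 3 * w j / n)"] by simp
    finally show ?thesis .
  qed
  then have "(\<Prod>j=1..R. accept_prob q (sample_test out n k \<nu> (R div j)))
      \<le> (\<Prod>j=1..R. exp (- (2 / 3 * w j / n)))"
    by (intro prod_mono) (simp add: accept_prob_nonneg)
  also have "\<dots> = exp (\<Sum>j=1..R. - (2 / 3 * w j / n))" by (simp add: exp_sum)
  also have "(\<Sum>j=1..R. - (2 / 3 * w j / n)) = - (2 / 3 * real (\<Sum>j=1..R. w j) / n)"
    by (simp add: sum_negf sum_distrib_left sum_divide_distrib)
  also have "exp (- (2 / 3 * real (\<Sum>j=1..R. w j) / n)) \<le> exp (- (4 / 3))"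
  proof -
    have "real (2 * n) \<le> real (\<Sum>j=1..R. w j)" using w by (rule of_nat_mono)
    then have "4 / 3 \<le> 2 / 3 * real (\<Sum>j=1..R. w j) / n"
      using assms(4) by (simp add: field_simps del: of_nat_sum)
    then show ?thesis by simp
  qed
  finally show ?thesis using exp_four_thirds by linarith
qed

text \<open>The factors of the other direction can only lower the acceptance probability.\<close>

lemma sampler_complete:
  assumes "answers_by q out nb" "arcs_of nb \<subseteq> {..<n} \<times> {..<n}" "\<And>u. distinct (nb u)" "n \<ge> 1"
    and "\<And>X. X \<in> F \<Longrightarrow> deficient k (arcs_of nb) {..<n} X" "disjoint F"
    and "\<And>X s. deficient k (arcs_of nb) {..<n} X \<Longrightarrow> k < card X \<Longrightarrow> card X \<le> s \<Longrightarrow>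
      (\<Sum>u\<in>X. Suc (length (nb u))) \<le> \<nu> s"
    and "5 * n \<le> R * card F"
  shows "accept_prob q (sampler n k \<nu> R) \<le> 1 / 3"
proof -
  have "accept_prob q (sampler n k \<nu> R) \<le> (\<Prod>j=1..R. accept_prob q (sample_test out n k \<nu> (R div j)))"
    unfolding sampler_def accept_prob_all_of
    by (intro prod_mono) (cases out; auto simp: accept_prob_nonneg accept_prob_both_le)
  also have "\<dots> \<le> 1 / 3" using assms by (rule all_of_samples_complete)
  finally show ?thesis .
qed

section \<open>From incidence lists to neighbour lists\<close>

lemma incidence_lists:
  assumes "digraph_on n G" "incidence_list_access G q"
  obtains nb nb' where
    "answers_by q True nb" "arcs_of nb = parcs G" "\<And>u. distinct (nb u)"
    "answers_by q False nb'" "arcs_of nb' = (parcs G)\<inverse>" "\<And>u. distinct (nb' u)"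
proof -
  obtain outs ins where lists:
      "\<And>v. distinct (outs v) \<and> set (outs v) = out_arcs (with_proj G) v"
      "\<And>v. distinct (ins v) \<and> set (ins v) = in_arcs (with_proj G) v"
    and q: "\<And>v i. q (OutEdge v i) = (if i < length (outs v) then Some (outs v ! i) else None)"
      "\<And>v i. q (InEdge v i) = (if i < length (ins v) then Some (ins v ! i) else None)"
    using assms(2) unfolding incidence_list_access_def by metis
  have out: "set (outs v) = {e \<in> parcs G. fst e = v}" and "in": "set (ins v) = {e \<in> parcs G. snd e = v}" for v
    using lists by (auto simp: out_arcs_def in_arcs_def)
  show ?thesis
  proof
    show "answers_by q True (\<lambda>v. map snd (outs v))" "answers_by q False (\<lambda>v. map fst (ins v))"
      by (auto simp: answers_by_def neighbour_def ask_def nth_opt_def q)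
    show "arcs_of (\<lambda>v. map snd (outs v)) = parcs G" "arcs_of (\<lambda>v. map fst (ins v)) = (parcs G)\<inverse>"
      by (auto simp: arcs_of_def out "in" image_iff)
    \<comment> \<open>Arcs in one list share an end, so distinct arcs have distinct other
      ends.\<close>
    show "distinct (map snd (outs v))" "distinct (map fst (ins v))" for v
      using lists[of v] out[of v] "in"[of v] by (auto simp: distinct_map inj_on_def prod_eq_iff)
  qed
qed

lemma length_neighbours:
  assumes "distinct (nb u)"
  shows "length (nb u) = card (arcs_of nb `` {u})"
proof -
  have "arcs_of nb `` {u} = set (nb u)" by (auto simp: arcs_of_def)
  then show ?thesis using assms by (simp add: distinct_card)
qed

text \<open>With a threshold \<open>B \<le> 16 k\<^sup>2\<close> of modifications, the query bounds allow to read the whole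
  graph. Above it, the \<open>O(k\<^sup>2)\<close> arcs that connect the hubs are negligible.\<close>

definition connectivity_tester ::
  "nat \<Rightarrow> nat \<Rightarrow> real \<Rightarrow> nat \<Rightarrow> (nat \<Rightarrow> nat) \<Rightarrow> randomized_algorithm" where
  "connectivity_tester n k B D \<nu> =
     (if n \<le> 1 \<or> k < n \<and> real (6 * k * n) \<le> B then return_pmf (Verdict True)
      else if n \<le> k then return_pmf (Verdict False)
      else if B \<le> real (16 * k\<^sup>2) then return_pmf (scan_tree True n k {..<n} (n * (D + 1) + 1))
      else sampler n k \<nu> (nat \<lceil>20 * k * n / B\<rceil>))"

lemma far_from_families:
  assumes G: "digraph_on n G" "n \<ge> 1" "far_from (k_edge_connected k) B G" and k: "k < n" "k \<ge> 1"
  obtains F F' where "B < 6 * k * n" "B < 8 * k\<^sup>2 + k * (card F + card F')"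
    "\<And>X. X \<in> F \<Longrightarrow> deficient k (parcs G) {..<n} X" "disjoint F"
    "\<And>X. X \<in> F' \<Longrightarrow> deficient k ((parcs G)\<inverse>) {..<n} X" "disjoint F'"
proof -
  interpret pair_fin_digraph G using G by (simp add: digraph_on_def)
  have V: "pverts G = {..<n}" using G by (simp add: digraph_on_def)
  have "parcs G \<subseteq> {..<n} \<times> {..<n}" unfolding V[symmetric] by (auto dest: wellformed')
  from augmentation[OF _ this, of k] k obtain H F F' where
      H: "parcs G \<subseteq> H" "H \<subseteq> {..<n} \<times> {..<n}" "\<nexists>X. deficient k H {..<n} X"
    and F: "\<forall>X\<in>F. deficient k (parcs G) {..<n} X" "disjoint F"
      "\<forall>X\<in>F'. deficient k ((parcs G)\<inverse>) {..<n} X" "disjoint F'"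
    and card: "card (H - parcs G) \<le> 6 * k * n" "card (H - parcs G) \<le> 8 * k\<^sup>2 + k * (card F + card F')"
    by auto
  let ?H = "\<lparr>pverts = {..<n}, parcs = H\<rparr>"
  have fin: "pair_fin_digraph ?H"
    using H(2) by unfold_locales (auto intro: finite_subset)
  have "k_edge_connected k ?H"
    using H(3) G(2) by (subst k_edge_connected_iff[OF fin]) (auto simp: lessThan_empty_iff)
  then have "B < edge_modifications G ?H"
    using G(3) fin unfolding far_from_def V by auto
  also have "edge_modifications G ?H = card (H - parcs G)"
    using H(1) by (simp add: edge_modifications_def Diff_eq_empty_iff[THEN iffD2])
  finally have "B < card (H - parcs G)" .
  then have "B < real (6 * k * n)" "B < real (8 * k\<^sup>2 + k * (card F + card F'))"
    using of_nat_mono[OF card(1), where 'a = real] of_nat_mono[OF card(2), where 'a = real] by linarith+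
  then show ?thesis using F by (intro that[of F F']) blast+
qed

lemma connectivity_tester_correct:
  assumes n: "n \<ge> 1" and k: "k \<ge> 1" and B: "B \<ge> 0"
    and Gs: "\<And>G. G \<in> Gs \<Longrightarrow> digraph_on n G"
    and D: "\<And>G u. G \<in> Gs \<Longrightarrow> card (parcs G `` {u}) \<le> D"
    and vol: "\<And>G X s. G \<in> Gs \<Longrightarrow> deficient k (parcs G) {..<n} X \<Longrightarrow> k < card X \<Longrightarrow> card X \<le> s \<Longrightarrow>
      (\<Sum>u\<in>X. Suc (card (parcs G `` {u}))) \<le> \<nu> s"
    and vol': "\<And>G X s. G \<in> Gs \<Longrightarrow> deficient k ((parcs G)\<inverse>) {..<n} X \<Longrightarrow> k < card X \<Longrightarrow> card X \<le> s \<Longrightarrow>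
      (\<Sum>u\<in>X. Suc (card ((parcs G)\<inverse> `` {u}))) \<le> \<nu> s"
  shows "one_sided_tester Gs (k_edge_connected k) B (connectivity_tester n k B D \<nu>)"
  unfolding one_sided_tester_def
proof (intro ballI allI impI)
  fix G q assume G: "G \<in> Gs" and q: "incidence_list_access G q"
  let ?E = "parcs G" and ?V = "{..<n}" and ?A = "connectivity_tester n k B D \<nu>"
  have dig: "digraph_on n G" and fin: "pair_fin_digraph G" and V: "pverts G = ?V"
    using Gs[OF G] by (auto simp: digraph_on_def)
  interpret pair_fin_digraph G by (fact fin)
  have E: "?E \<subseteq> ?V \<times> ?V" unfolding V[symmetric] by (auto dest: wellformed')
  have con: "k_edge_connected k G \<longleftrightarrow> (\<nexists>X. deficient k ?E ?V X)"
    using k_edge_connected_iff[OF fin] n V by (auto simp: lessThan_empty_iff)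
  obtain nb nb' where
      nb: "answers_by q True nb" "arcs_of nb = ?E" "\<And>u. distinct (nb u)"
    and nb': "answers_by q False nb'" "arcs_of nb' = ?E\<inverse>" "\<And>u. distinct (nb' u)"
    using incidence_lists[OF dig q] by metis
  have len: "length (nb u) = card (?E `` {u})" "length (nb' u) = card (?E\<inverse> `` {u})" for u
    using length_neighbours[of nb u] length_neighbours[of nb' u] nb nb' by simp_all
  \<comment> \<open>A vertex has at most n - 1 < k non-loop out-arcs, which justifies immediate
    rejection.\<close>
  have many: "deficient k ?E ?V {0}" if "n > 1" "n \<le> k"
  proof -
    have "cut_size ?E {0} \<le> card ({0 :: nat} \<times> ({..<n} - {0}))"
      unfolding cut_size_def by (rule card_mono) (use E in auto)
    also have "\<dots> < n" using n by (simp add: card_cartesian_product)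
    finally show ?thesis using that by (auto simp: deficient_def)
  qed
  show "(k_edge_connected k G \<longrightarrow> accept_prob q ?A = 1) \<and>
      (far_from (k_edge_connected k) B G \<longrightarrow> reject_prob q ?A \<ge> 2 / 3)"
  proof (intro conjI impI)
    assume "k_edge_connected k G"
    then have no: "\<nexists>X. deficient k ?E ?V X" using con by simp
    then have no': "\<nexists>X. deficient k (?E\<inverse>) ?V X" using deficient_converse[OF E] by simp
    have "always_accepts q (sample_test True n k \<nu> s)" "always_accepts q (sample_test False n k \<nu> s)" for s
      using always_accepts_sample_test[OF nb(1)] always_accepts_sample_test[OF nb'(1)]
        no no' nb(2) nb'(2) by simp_all
    then have "always_accepts q (sampler n k \<nu> R)" for R
      unfolding sampler_def by (intro always_accepts_all_of always_accepts_both)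
    moreover have "accepts q (scan_tree True n k S f)" for S f
      using scan_tree_sound[OF nb(1)] no nb(2) by simp
    moreover have "n \<le> 1 \<or> k < n" using no many by force
    ultimately show "accept_prob q ?A = 1"
      unfolding connectivity_tester_def
      by (auto simp: accept_prob_return intro: accept_prob_eq_1)
  next
    assume far: "far_from (k_edge_connected k) B G"
    have "edge_modifications G G = 0" by (simp add: edge_modifications_def)
    with far fin B have not_con: "\<not> k_edge_connected k G" unfolding far_from_def by fastforce
    then obtain X where X: "deficient k ?E ?V X" using con by blast
    then have "n > 1" using n by (cases "n = 1") (auto simp: deficient_def lessThan_Suc)
    have "accept_prob q ?A \<le> 1 / 3"
    proof (cases "k < n")
      case False
      then show ?thesis using \<open>n > 1\<close> by (simp add: connectivity_tester_def accept_prob_return)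
    next
      case True
      obtain F F' where small: "B < 6 * k * n" and fam: "B < 8 * k\<^sup>2 + k * (card F + card F')"
        and F: "\<And>X. X \<in> F \<Longrightarrow> deficient k ?E ?V X" "disjoint F"
        and F': "\<And>X. X \<in> F' \<Longrightarrow> deficient k (?E\<inverse>) ?V X" "disjoint F'"
        by (rule far_from_families[OF dig n far True k]) blast
      show ?thesis
      proof (cases "B \<le> real (16 * k\<^sup>2)")
        case True
        have "(\<Sum>u<n. Suc (length (nb u))) \<le> (\<Sum>u<n. D + 1)"
          using D[OF G] len by (intro sum_mono) simp
        then have "\<not> accepts q (scan_tree True n k ?V (n * (D + 1) + 1))"
          using X nb(2) by (intro scan_tree_complete[OF nb(1), of k n X]) (auto simp: deficient_def)
        then show ?thesis using True small \<open>k < n\<close> \<open>n > 1\<close>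
          by (simp add: connectivity_tester_def accept_prob_return)
      next
        case False
        define R where "R = nat \<lceil>20 * k * n / B\<rceil>"
        have A: "?A = sampler n k \<nu> R"
          using False small \<open>k < n\<close> \<open>n > 1\<close> by (simp add: connectivity_tester_def R_def)
        have Bpos: "B > 0" using False of_nat_0_le_iff[of "16 * k\<^sup>2", where 'a = real] by linarith
        have R: "20 * k * n / B \<le> R" unfolding R_def by linarith
        \<comment> \<open>(20 k n / B) (B / (4 k)) = 5 n, the weight that the sampler
          requires.\<close>
        have enough: "5 * n \<le> R * p" if p: "B < 4 * k * p" for p :: nat
        proof -
          have "real (5 * n) * B \<le> real (5 * n) * (4 * k * p)" using p by (intro mult_left_mono) auto
          also have "\<dots> = (20 * k * n / B) * p * B" using Bpos by simp
          also have "\<dots> \<le> real R * real p * B" using R Bpos by (intro mult_right_mono) auto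
          finally have "real (5 * n) \<le> real (R * p)" using Bpos by simp
          then show ?thesis by (simp only: of_nat_le_iff)
        qed
        \<comment> \<open>Here 8 k^2 is below B / 2, so one of the two families has more than B / (4
          k) members.\<close>
        have "B < 2 * k * (card F + card F')" using fam False by (simp add: algebra_simps)
        then consider "B < 4 * k * card F" | "B < 4 * k * card F'"
          by (force simp: algebra_simps)
        then show ?thesis
        proof cases
          case 1
          show ?thesis unfolding A
            by (rule sampler_complete[OF nb(1) _ nb(3) n, where F = F])
              (use F E vol[OF G] enough[OF 1] nb(2) len in auto)
        next
          case 2
          show ?thesis unfolding A
            by (rule sampler_complete[OF nb'(1) _ nb'(3) n, where F = F'])
              (use F' E vol'[OF G] enough[OF 2] nb'(2) len in auto)
        qed
      qed
    qed
    then show "reject_prob q ?A \<ge> 2 / 3" unfolding reject_prob_eq by simp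
  qed
qed

section \<open>Query complexity\<close>

text \<open>An arc with its tail in \<open>X\<close> either leaves \<open>X\<close> or is one of the
  pairs in \<open>X \<times> X\<close>.\<close>

lemma sum_out_degrees_le:
  assumes "finite E" "finite X"
  shows "(\<Sum>u\<in>X. card (E `` {u})) \<le> card X * card X + cut_size E X"
proof -
  have "(\<Sum>u\<in>X. card (E `` {u})) = card (SIGMA u:X. E `` {u})"
    using assms by (subst card_SigmaI) (auto intro: finite_Image)
  also have "\<dots> \<le> card (X \<times> X \<union> (E \<inter> X \<times> - X))"
    using assms by (intro card_mono) auto
  also have "\<dots> \<le> card (X \<times> X) + card (E \<inter> X \<times> - X)" by (rule card_Un_le)
  finally show ?thesis by (simp add: cut_size_def card_cartesian_product)
qed

text \<open>Telescoping with 1 / (R + 1)^2 \<le> 1 / R - 1 / (R + 1).\<close>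

lemma sum_inverse_squares_le: "R \<ge> 1 \<Longrightarrow> (\<Sum>j=1..R. 1 / real j ^ 2) \<le> 2 - 1 / R"
proof (induction R rule: nat_induct_at_least)
  case (Suc R)
  have "1 / real (Suc R) ^ 2 \<le> 1 / (R * Suc R)"
    by (intro frac_le) (use Suc in \<open>auto simp: power2_eq_square algebra_simps intro: add_pos_nonneg\<close>)
  also have "\<dots> = 1 / R - 1 / Suc R" using Suc by (subst diff_frac_eq) (auto simp: algebra_simps)
  finally show ?case using Suc by simp
qed simp

lemma harmonic_sum_le: "R \<ge> 1 \<Longrightarrow> (\<Sum>j=1..R. 1 / real j) \<le> 1 + ln R"
proof (induction R rule: nat_induct_at_least)
  case (Suc R)
  have "ln (real R / Suc R) \<le> real R / Suc R - 1" using Suc by (intro ln_le_minus_one) simp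
  also have "\<dots> = - (1 / Suc R)" by (simp add: field_simps)
  finally have "1 / Suc R \<le> ln (Suc R) - ln R" using Suc by (simp add: ln_div)
  with Suc show ?case by simp
qed simp

lemma connectivity_tester_queries:
  assumes "n \<ge> 1" "k \<ge> 1" "B > 0" "\<And>s. k < s \<Longrightarrow> \<nu> s > 0" "t \<ge> 0"
    and full: "B \<le> real (16 * k\<^sup>2) \<Longrightarrow> real (n * (D + 1) + 1) \<le> t"
    and samples: "\<And>R. R \<ge> 1 \<Longrightarrow> real R \<le> 26 * (real k * real n / B) \<Longrightarrow>
      real (\<Sum>j=1..R. 2 * (k + 2 + (if k < R div j then 3 * k * k * \<nu> (R div j) else 0))) \<le> t"
  shows "performs_at_most Gs (connectivity_tester n k B D \<nu>) t"
proof -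
  have perf: "performs_at_most Gs A t" if "queries_at_most A b" "real b \<le> t" for A b
    using that unfolding performs_at_most_def queries_at_most_def by (meson of_nat_mono order_trans)
  consider "n \<le> 1 \<or> k < n \<and> real (6 * k * n) \<le> B" | "n \<le> k" "n > 1"
    | "k < n" "n > 1" "B < real (6 * k * n)" "B \<le> real (16 * k\<^sup>2)"
    | "k < n" "n > 1" "B < real (6 * k * n)" "\<not> B \<le> real (16 * k\<^sup>2)"
    by linarith
  then show ?thesis
  proof cases
    case 3
    have "queries_at_most (return_pmf (scan_tree True n k {..<n} (n * (D + 1) + 1))) (n * (D + 1) + 1)"
      unfolding queries_at_most_def by (auto intro: num_queries_scan_tree)
    then show ?thesis using perf full 3 by (simp add: connectivity_tester_def)
  next
    case 4
    define R where "R = nat \<lceil>20 * k * n / B\<rceil>"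
    \<comment> \<open>In the sampling branch B < 6 k n, so rounding up costs at most 6 k n / B; this
      makes 20 + 6 = 26.\<close>
    have r: "1 < 6 * (real k * real n / B)" using 4 assms(3) by (simp add: field_simps)
    have R: "R = nat \<lceil>20 * (real k * real n / B)\<rceil>" by (simp add: R_def mult.assoc)
    have "real R \<le> 20 * (real k * real n / B) + 1" unfolding R using r by linarith
    with r have "real R \<le> 26 * (real k * real n / B)" by linarith
    moreover have "20 * (real k * real n / B) \<le> real R" unfolding R by linarith
    then have "R \<ge> 1" using r by linarith
    ultimately have "performs_at_most Gs (sampler n k \<nu> R) t"
      using samples by (intro perf[OF queries_at_most_sampler]) (use assms in auto)
    then show ?thesis using 4 by (simp add: connectivity_tester_def R_def)
  qed (use assms in \<open>auto simp: connectivity_tester_def performs_at_most_def\<close>)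
qed

text \<open>Two directions at 3 k^2 times 3 s^2 queries give 18; the series of inverse squares is at
  most 2, and the vertex scans add 6, in total 42.\<close>

lemma sampler_queries_quadratic:
  assumes "R \<ge> 1" "k \<ge> 1"
  shows "real (\<Sum>j=1..R. 2 * (k + 2 + (if k < R div j then 3 * k * k * (3 * (R div j) * (R div j)) else 0)))
    \<le> 42 * (real k)\<^sup>2 * (real R)\<^sup>2"
proof -
  have "real (2 * (k + 2 + (if k < R div j then 3 * k * k * (3 * (R div j) * (R div j)) else 0)))
      \<le> 6 * k + 18 * (real k)\<^sup>2 * (real R)\<^sup>2 * (1 / real j ^ 2)" for j
  proof -
    have "real (R div j) * real (R div j) \<le> (R / j) * (R / j)"
      by (intro mult_mono of_nat_div_le_of_nat) auto
    then have "18 * (real k)\<^sup>2 * (real (R div j) * real (R div j)) \<le> 18 * (real k)\<^sup>2 * ((R / j) * (R / j))"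
      by (intro mult_left_mono) auto
    moreover have "real (2 * (k + 2 + (if k < R div j then 3 * k * k * (3 * (R div j) * (R div j)) else 0)))
        \<le> 6 * k + 18 * (real k)\<^sup>2 * (real (R div j) * real (R div j))"
    proof (cases "k < R div j")
      case True
      then show ?thesis using assms(2) by (simp add: power2_eq_square algebra_simps)
    next
      case False
      have "0 \<le> 18 * (real k)\<^sup>2 * (real (R div j) * real (R div j))" by simp
      moreover have "real (2 * (k + 2)) \<le> 6 * k" using assms(2) by simp
      ultimately show ?thesis using False by (simp only: if_False add_0_right)
    qed
    ultimately show ?thesis by (simp add: power2_eq_square)
  qed
  then have "real (\<Sum>j=1..R. 2 * (k + 2 + (if k < R div j then 3 * k * k * (3 * (R div j) * (R div j)) else 0)))
      \<le> (\<Sum>j=1..R. 6 * k + 18 * (real k)\<^sup>2 * (real R)\<^sup>2 * (1 / real j ^ 2))"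
    unfolding of_nat_sum by (intro sum_mono)
  also have "\<dots> = 6 * k * R + 18 * (real k)\<^sup>2 * (real R)\<^sup>2 * (\<Sum>j=1..R. 1 / real j ^ 2)"
    by (simp add: sum.distrib sum_distrib_left)
  also have "\<dots> \<le> 6 * (real k)\<^sup>2 * (real R)\<^sup>2 + 18 * (real k)\<^sup>2 * (real R)\<^sup>2 * 2"
  proof (intro add_mono mult_left_mono)
    have "real k * real R * 1 \<le> real k * real R * (real k * real R)"
      using assms by (intro mult_left_mono) (auto simp: mult_ge1_I)
    then show "real (6 * k * R) \<le> 6 * (real k)\<^sup>2 * (real R)\<^sup>2"
      by (simp add: power2_eq_square algebra_simps)
    show "(\<Sum>j=1..R. 1 / real j ^ 2) \<le> 2"
      by (rule order_trans[OF sum_inverse_squares_le[OF assms(1)]]) simp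
  qed simp
  also have "\<dots> = 42 * (real k)\<^sup>2 * (real R)\<^sup>2" by simp
  finally show ?thesis .
qed

text \<open>Two directions at 3 k^2 and d + 1 \<le> 2 d give 12 times a harmonic sum; the vertex
  scans add 6.\<close>

lemma sampler_queries_linear:
  assumes "R \<ge> 1" "k \<ge> 1" "d \<ge> 1"
  shows "real (\<Sum>j=1..R. 2 * (k + 2 + (if k < R div j then 3 * k * k * ((R div j) * (d + 1)) else 0)))
    \<le> 18 * (real k)\<^sup>2 * d * R * (1 + ln R)"
proof -
  have "real (2 * (k + 2 + (if k < R div j then 3 * k * k * ((R div j) * (d + 1)) else 0)))
      \<le> 6 * k + 12 * (real k)\<^sup>2 * d * R * (1 / real j)" for j
  proof -
    have "real (R div j) * real (d + 1) \<le> (R / j) * (2 * d)"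
      using assms by (intro mult_mono of_nat_div_le_of_nat) auto
    then have "6 * (real k)\<^sup>2 * (real (R div j) * real (d + 1)) \<le> 6 * (real k)\<^sup>2 * ((R / j) * (2 * d))"
      by (intro mult_left_mono) auto
    moreover have "real (2 * (k + 2 + (if k < R div j then 3 * k * k * ((R div j) * (d + 1)) else 0)))
        \<le> 6 * k + 6 * (real k)\<^sup>2 * (real (R div j) * real (d + 1))"
    proof (cases "k < R div j")
      case True
      then show ?thesis using assms(2) by (simp add: power2_eq_square algebra_simps)
    next
      case False
      have "0 \<le> 6 * (real k)\<^sup>2 * (real (R div j) * real (d + 1))" by simp
      moreover have "real (2 * (k + 2)) \<le> 6 * k" using assms(2) by simp
      ultimately show ?thesis using False by (simp only: if_False add_0_right)
    qed
    ultimately show ?thesis by (simp add: algebra_simps)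
  qed
  then have "real (\<Sum>j=1..R. 2 * (k + 2 + (if k < R div j then 3 * k * k * ((R div j) * (d + 1)) else 0)))
      \<le> (\<Sum>j=1..R. 6 * k + 12 * (real k)\<^sup>2 * d * R * (1 / real j))"
    unfolding of_nat_sum by (intro sum_mono)
  also have "\<dots> = 6 * k * R + 12 * (real k)\<^sup>2 * d * R * (\<Sum>j=1..R. 1 / real j)"
    by (simp add: sum.distrib sum_distrib_left)
  also have "\<dots> \<le> 6 * (real k)\<^sup>2 * d * R * (1 + ln R) + 12 * (real k)\<^sup>2 * d * R * (1 + ln R)"
  proof (intro add_mono mult_left_mono harmonic_sum_le)
    have "real k * real R * 1 \<le> real k * real R * (real k * real d * (1 + ln R))"
      using assms by (intro mult_left_mono mult_ge1_I) auto
    then show "real (6 * k * R) \<le> 6 * (real k)\<^sup>2 * d * R * (1 + ln R)"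
      by (simp add: power2_eq_square algebra_simps)
  qed (use assms in auto)
  also have "\<dots> = 18 * (real k)\<^sup>2 * d * R * (1 + ln R)" by simp
  finally show ?thesis .
qed

lemma O_log_ge_1: "1 \<le> O_log x" and ln_le_O_log: "ln x \<le> O_log x"
  by (simp_all add: O_log_def)

theorem theorem27:
  shows
    "(\<exists>(A :: nat \<Rightarrow> nat \<Rightarrow> real \<Rightarrow> nat \<Rightarrow> randomized_algorithm) (C :: real).
        \<forall>(n :: nat) (m :: nat) (\<epsilon> :: real) (k :: nat). n \<ge> 1 \<and> \<epsilon> > 0 \<and> k \<ge> 1 \<longrightarrow>
          (let avg = real m / real n in
             one_sided_tester (graphs_with_edges n m) (k_edge_connected k) (\<epsilon> * real n * avg)
               (A n m \<epsilon> k) \<and>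
             (m \<ge> 1 \<longrightarrow>
                performs_at_most (graphs_with_edges n m) (A n m \<epsilon> k)
                  (C * (real k ^ 4 / (\<epsilon> * avg) ^ 2 * O_log (real k / (\<epsilon> * avg)))))))
     \<and>
     (\<exists>(A :: nat \<Rightarrow> nat \<Rightarrow> real \<Rightarrow> nat \<Rightarrow> randomized_algorithm) (C :: real).
        \<forall>(n :: nat) (d :: nat) (\<epsilon> :: real) (k :: nat). n \<ge> 1 \<and> \<epsilon> > 0 \<and> k \<ge> 1 \<longrightarrow>
          one_sided_tester (graphs_with_degree_bound n d) (k_edge_connected k)
            (\<epsilon> * real n * real d) (A n d \<epsilon> k) \<and>
          (d \<ge> 1 \<longrightarrow>
             performs_at_most (graphs_with_degree_bound n d) (A n d \<epsilon> k)
               (C * (real k ^ 3 / \<epsilon> * (O_log (real k / (\<epsilon> * real d))) ^ 2))))"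
proof (intro conjI exI allI impI)
  fix n m k :: nat and \<epsilon> :: real
  assume asm: "n \<ge> 1 \<and> \<epsilon> > 0 \<and> k \<ge> 1"
  define B where "B = \<epsilon> * real n * (real m / real n)"
  let ?A = "connectivity_tester n k B n (\<lambda>s. 3 * s * s)"
  have arcs: "parcs G \<subseteq> {..<n} \<times> {..<n}" "finite (parcs G)" if "digraph_on n G" for G
  proof -
    interpret pair_fin_digraph G using that by (simp add: digraph_on_def)
    show "finite (parcs G)" by (rule pair_finite_arcs)
    have "pverts G = {..<n}" using that by (simp add: digraph_on_def)
    then show "parcs G \<subseteq> {..<n} \<times> {..<n}" by (auto dest: wellformed')
  qed
  \<comment> \<open>For c = \<open>card X\<close>: at most c^2 arcs stay inside, fewer than k < c
    leave, and there are c end markers, in total at most 3 c^2.\<close>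
  have vol: "(\<Sum>u\<in>X. Suc (card (E `` {u}))) \<le> 3 * s * s"
    if "finite E" "deficient k E {..<n} X" "k < card X" "card X \<le> s" for E X s
  proof -
    have "finite X" using that(2) unfolding deficient_def by (auto intro: finite_subset)
    have "(\<Sum>u\<in>X. Suc (card (E `` {u}))) = (\<Sum>u\<in>X. card (E `` {u})) + card X"
      by (simp add: sum_Suc)
    also have "\<dots> \<le> (card X * card X + card X) + card X"
      using sum_out_degrees_le[OF that(1) \<open>finite X\<close>] that(2,3) by (simp add: deficient_def)
    also have "\<dots> \<le> 3 * (card X * card X)" using that(3) by (cases "card X") auto
    also have "\<dots> \<le> 3 * (s * s)" using that(4) by (intro mult_le_mono) auto
    finally show ?thesis by simp
  qed
  have "one_sided_tester (graphs_with_edges n m) (k_edge_connected k) B ?A"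
  proof (rule connectivity_tester_correct)
    fix G u assume "G \<in> graphs_with_edges n m"
    then have "parcs G `` {u} \<subseteq> {..<n}" using arcs(1) by (auto simp: graphs_with_edges_def)
    then show "card (parcs G `` {u}) \<le> n" using subset_eq_atLeast0_lessThan_card by (simp add: lessThan_atLeast0)
  qed (use asm arcs(2) vol in \<open>auto simp: graphs_with_edges_def B_def\<close>)
  moreover have "performs_at_most (graphs_with_edges n m) ?A
      (30000 * (real k ^ 4 / (\<epsilon> * (real m / real n)) ^ 2 * O_log (real k / (\<epsilon> * (real m / real n)))))"
    (is "performs_at_most _ _ (30000 * (?b * ?L))") if "m \<ge> 1"
  proof -
    have n: "n > 0" and k: "k \<ge> 1" and e: "\<epsilon> > 0" using asm by auto
    have Bpos: "B > 0" using asm that by (simp add: B_def)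
    have b: "?b = real k ^ 4 * (n / B)\<^sup>2"
      using asm that unfolding B_def by (simp add: field_simps power2_eq_square)
    have b0: "0 \<le> ?b" unfolding b by simp
    have bL: "?b \<le> ?b * ?L" using mult_left_mono[OF O_log_ge_1 b0] by simp
    show ?thesis
    proof (rule connectivity_tester_queries)
      show "0 \<le> 30000 * (?b * ?L)" using b0 bL by linarith
    next
      assume small: "B \<le> real (16 * k\<^sup>2)"
      \<comment> \<open>Squaring B \<le> 16 k^2 shows that n^2 is at most 256 k^4 (n / B)^2, so the
        whole graph can be read.\<close>
      have "(B / (16 * k\<^sup>2)) ^ 2 \<le> 1" using small Bpos k by (intro power_le_one) auto
      then have "B\<^sup>2 \<le> 256 * real k ^ 4" using k by (simp add: field_simps power2_eq_square power4_eq_xxxx)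
      then have "real n ^ 2 \<le> 256 * ?b"
        unfolding b using Bpos mult_left_mono[of "B\<^sup>2" "256 * real k ^ 4" "(n / B)\<^sup>2"]
        by (simp add: power_divide field_simps)
      moreover have "n * (n + 1) + 1 \<le> 3 * n ^ 2" using n by (cases n) (auto simp: power2_eq_square)
      then have "real (n * (n + 1) + 1) \<le> 3 * real n ^ 2" by (metis of_nat_le_iff of_nat_mult of_nat_numeral of_nat_power)
      ultimately show "real (n * (n + 1) + 1) \<le> 30000 * (?b * ?L)" using b0 bL by linarith
    next
      fix R assume R: "R \<ge> 1" "real R \<le> 26 * (real k * real n / B)"
      \<comment> \<open>The constant is 42 * 26^2 = 28392; the logarithmic factor, being at least 1,
        absorbs the rest.\<close>
      have "42 * (real k)\<^sup>2 * (real R)\<^sup>2 \<le> 42 * (real k)\<^sup>2 * (26 * (real k * real n / B))\<^sup>2"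
        using R by (intro mult_left_mono power_mono) auto
      also have "\<dots> = 28392 * ?b" unfolding b by (simp add: power2_eq_square power4_eq_xxxx)
      also have "\<dots> \<le> 30000 * (?b * ?L)" using b0 bL by linarith
      finally show "real (\<Sum>j=1..R. 2 * (k + 2 + (if k < R div j
          then 3 * k * k * (3 * (R div j) * (R div j)) else 0))) \<le> 30000 * (?b * ?L)"
        using sampler_queries_quadratic[OF R(1) k] by linarith
    qed (use n k Bpos in auto)
  qed
  ultimately show "let avg = real m / real n in
      one_sided_tester (graphs_with_edges n m) (k_edge_connected k) (\<epsilon> * real n * avg)
        (connectivity_tester n k (\<epsilon> * real n * (real m / real n)) n (\<lambda>s. 3 * s * s)) \<and>
      (m \<ge> 1 \<longrightarrow> performs_at_most (graphs_with_edges n m)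
        (connectivity_tester n k (\<epsilon> * real n * (real m / real n)) n (\<lambda>s. 3 * s * s))
        (30000 * (real k ^ 4 / (\<epsilon> * avg) ^ 2 * O_log (real k / (\<epsilon> * avg)))))"
    unfolding Let_def B_def by blast
next
  fix n d k :: nat and \<epsilon> :: real
  assume asm: "n \<ge> 1 \<and> \<epsilon> > 0 \<and> k \<ge> 1"
  let ?B = "\<epsilon> * real n * real d"
  have deg: "card (parcs G `` {u}) \<le> d" "card ((parcs G)\<inverse> `` {u}) \<le> d"
    if "G \<in> graphs_with_degree_bound n d" for G u
  proof -
    interpret pair_fin_digraph G using that by (simp add: graphs_with_degree_bound_def digraph_on_def)
    have "parcs G `` {u} = snd ` out_arcs (with_proj G) u"
      "(parcs G)\<inverse> `` {u} = fst ` in_arcs (with_proj G) u"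
      by (auto simp: out_arcs_def in_arcs_def image_iff)
    then have le: "card (parcs G `` {u}) \<le> out_degree (with_proj G) u"
      "card ((parcs G)\<inverse> `` {u}) \<le> in_degree (with_proj G) u"
      unfolding out_degree_def in_degree_def by (auto intro: card_image_le)
    have "parcs G `` {u} = {}" "(parcs G)\<inverse> `` {u} = {}" if "u \<notin> pverts G"
      using that by (auto dest: wellformed')
    with le that show "card (parcs G `` {u}) \<le> d" "card ((parcs G)\<inverse> `` {u}) \<le> d"
      by (cases "u \<in> pverts G"; force simp: graphs_with_degree_bound_def)+
  qed
  have vol: "(\<Sum>u\<in>X. Suc (card (E `` {u}))) \<le> s * (d + 1)"
    if "\<And>u. card (E `` {u}) \<le> d" "card X \<le> s" for E :: "nat rel" and X s
  proof -
    have "(\<Sum>u\<in>X. Suc (card (E `` {u}))) \<le> (\<Sum>u\<in>X. d + 1)" using that(1) by (intro sum_mono) simp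
    also have "\<dots> \<le> s * (d + 1)" using that(2) by (simp del: add_Suc_right)
    finally show ?thesis .
  qed
  show "one_sided_tester (graphs_with_degree_bound n d) (k_edge_connected k) ?B
      (connectivity_tester n k ?B d (\<lambda>s. s * (d + 1)))"
  proof (rule connectivity_tester_correct)
    fix G and X :: "nat set" and s assume G: "G \<in> graphs_with_degree_bound n d" and "card X \<le> s"
    show "(\<Sum>u\<in>X. Suc (card (parcs G `` {u}))) \<le> s * (d + 1)"
      "(\<Sum>u\<in>X. Suc (card ((parcs G)\<inverse> `` {u}))) \<le> s * (d + 1)"
      by (rule vol[OF deg(1)[OF G] \<open>card X \<le> s\<close>], rule vol[OF deg(2)[OF G] \<open>card X \<le> s\<close>])
  qed (use asm deg in \<open>auto simp: graphs_with_degree_bound_def\<close>)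
  assume d: "d \<ge> 1"
  have n: "n > 0" and k: "k \<ge> 1" and e: "\<epsilon> > 0" using asm by auto
  let ?b = "real k ^ 3 / \<epsilon>" and ?L = "O_log (real k / (\<epsilon> * real d))"
  have b: "?b > 0" using k e by simp
  have "?L \<le> ?L\<^sup>2" using O_log_ge_1[of "real k / (\<epsilon> * real d)"] by (simp add: self_le_power)
  then have bL: "?b * ?L \<le> ?b * ?L\<^sup>2" using b by (intro mult_left_mono) auto
  have b1: "?b \<le> ?b * ?L" using mult_left_mono[OF O_log_ge_1, of ?b] b by simp
  show "performs_at_most (graphs_with_degree_bound n d)
      (connectivity_tester n k ?B d (\<lambda>s. s * (d + 1))) (13000 * (?b * ?L\<^sup>2))"
  proof (rule connectivity_tester_queries)
    show "0 \<le> 13000 * (?b * ?L\<^sup>2)" using bL b1 b by linarith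
  next
    assume "?B \<le> real (16 * k\<^sup>2)"
    then have "real n * d \<le> 16 * (k\<^sup>2 / \<epsilon>)" using e by (simp add: field_simps)
    also have "\<dots> \<le> 16 * ?b" using e k by (intro mult_left_mono divide_right_mono) (auto intro: power_increasing)
    finally have "real n * d \<le> 16 * ?b" .
    moreover have "n * (d + 1) + 1 \<le> 3 * (n * d)" using n d by (cases n; cases d) auto
    then have "real (n * (d + 1) + 1) \<le> 3 * (real n * d)" by (metis of_nat_le_iff of_nat_mult of_nat_numeral)
    ultimately show "real (n * (d + 1) + 1) \<le> 13000 * (?b * ?L\<^sup>2)" using bL b1 b by linarith
  next
    fix R assume R: "R \<ge> 1" "real R \<le> 26 * (real k * real n / ?B)"
    let ?r = "real k / (\<epsilon> * d)"
    have r: "?r > 0" using k e d by simp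
    have R': "real R \<le> 26 * ?r" using R(2) n by simp
    have "ln (real R) \<le> ln (26 * ?r)" using R R' by (intro ln_mono) auto
    also have "\<dots> = ln 26 + ln ?r" by (rule ln_mult_pos[OF _ r]) simp
    also have "ln (26 :: real) \<le> 25" using ln_le_minus_one[of "26 :: real"] by simp
    \<comment> \<open>The sum 1 + 25 + ln of the ratio is at most 27 \<open>?L\<close> because
      \<open>?L\<close> is at least 1; then 18 * 26 * 27 = 12636.\<close>
    finally have "1 + ln (real R) \<le> 27 * ?L"
      using ln_le_O_log[of ?r] O_log_ge_1[of ?r] by linarith
    then have "18 * (real k)\<^sup>2 * d * R * (1 + ln R) \<le> 18 * (real k)\<^sup>2 * d * (26 * ?r) * (27 * ?L)"
      using R(1) R' e by (intro mult_mono) auto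
    also have "\<dots> = 12636 * (?b * ?L)" using d e by (simp add: power2_eq_square power3_eq_cube)
    also have "\<dots> \<le> 13000 * (?b * ?L\<^sup>2)" using bL b1 b by linarith
    finally show "real (\<Sum>j=1..R. 2 * (k + 2 + (if k < R div j
        then 3 * k * k * ((R div j) * (d + 1)) else 0))) \<le> 13000 * (?b * ?L\<^sup>2)"
      using sampler_queries_linear[OF R(1) k d] by linarith
  qed (use n k e d in auto)
qed

end
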